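(* Let $D$ be a probability distribution on $[0,1)$, let $x_1\in[0,1)$, and let $X=(X_n)_{n\in\mathbb{N}}$ be the random walk on the torus starting in $x_1$ with step distribution $D$; that is, $X_1=x_1$ and $X_{N+1}=\{X_N+Y_N\}$ for $N\in\mathbb{N}$, where $(Y_n)_{n\in\mathbb{N}}$ are independent and identically distributed random variables on $[0,1)$ with distribution $D$. Assume that $D$ has a Lebesgue density in $L^p([0,1))$ for some $p\in[1,\infty]$. (i) If $p>1$, then $X$ almost surely has Poissonian pair correlations. (ii) If $p=1$, then one still has $\lim_{N\to\infty}\mathbb{E}(R(s,N))=2s$ for all $s\ge 0$.
   Context: $\{\cdot\}$ denotes the fractional part of a real number and $\|\cdot\|$ denotes the distance of a real number to its closest integer. For a sequence $x=(x_n)_{n\in\mathbb{N}}$ in $[0,1)$, $N\in\mathbb{N}$ and $s\ge 0$, put $$R(s,N)=\frac1N\,\#\left\{(i,j): 1\le i\ne j\le N,\ \|x_i-x_j\|\le \frac{s}{N}\right\}.$$ The sequence $x$ has Poissonian pair correlations (PPC) if $\lim_{N\to\infty}R(s,N)=2s$ for all $s\ge 0$. For a random sequence $X$, $R(s,N)$ is the random variable obtained by inserting $X$ for $x$. *)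

theory Defs
  imports "HOL-Probability.Probability"
begin

definition dist_nearest_int :: "real \<Rightarrow> real" where
  "dist_nearest_int x = \<bar>x - of_int (round x)\<bar>"

text \<open>Sequences are indexed from 1; the value at index 0 is never used.\<close>

definition pair_corr :: "(nat \<Rightarrow> real) \<Rightarrow> real \<Rightarrow> nat \<Rightarrow> real" where
  "pair_corr x s N =
     real (card {(i, j). i \<in> {1..N} \<and> j \<in> {1..N} \<and> i \<noteq> j \<and>
                         dist_nearest_int (x i - x j) \<le> s / real N}) / real N"

definition poissonian_pair_correlations :: "(nat \<Rightarrow> real) \<Rightarrow> bool" where
  "poissonian_pair_correlations x \<longleftrightarrow>
     (\<forall>s\<ge>0. (\<lambda>N. pair_corr x s N) \<longlonglongrightarrow> 2 * s)"

text \<open>Only used for \<open>1 \<le> p\<close>. Elements are functions, not classes modulo null sets.\<close>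

definition Lp :: "ennreal \<Rightarrow> 'a measure \<Rightarrow> ('a \<Rightarrow> real) set" where
  "Lp p M = {f \<in> borel_measurable M.
     if p = \<infinity> then esssup M (\<lambda>x. ereal \<bar>f x\<bar>) < \<infinity>
     else integrable M (\<lambda>x. \<bar>f x\<bar> powr enn2real p)}"

text \<open>Lebesgue measure on the Borel sets of \<open>[0,1)\<close>; its underlying space is \<open>[0,1)\<close>.\<close>

abbreviation lborel_unit :: "real measure" where
  "lborel_unit \<equiv> restrict_space lborel {0..<1}"

text \<open>The nonnegativity requirement is not redundant: \<open>ennreal\<close> truncates negative
  values to 0.\<close>

definition has_Lp_density :: "ennreal \<Rightarrow> real measure \<Rightarrow> bool" where
  "has_Lp_density p D \<longleftrightarrow>
     (\<exists>f \<in> Lp p lborel_unit. (AE t in lborel_unit. 0 \<le> f t) \<and>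
        D = density lborel_unit (\<lambda>t. ennreal (f t)))"

end

theory Submission
  imports Defs "HOL-Real_Asymp.Real_Asymp"
begin

text \<open>Modulo 1, \<open>X j - X i\<close> is a sum of \<open>j - i\<close> independent steps. Some convolution power of an
  absolutely continuous law dominates a multiple of Lebesgue measure on the torus (Doeblin's
  condition), so the law of a sum of \<open>n\<close> steps converges to the uniform distribution in total
  variation at a rate \<open>C * \<theta> ^ n\<close>. For (ii), the expected excess of the pair count over \<open>2 * s\<close>
  is bounded by a sum over \<open>n = j - i\<close> of terms that tend to 0 individually and are dominated by
  \<open>C * \<theta> ^ n\<close>. For (i), an \<open>L^p\<close> density makes the probability of \<open>\<parallel>X j - X i\<parallel> \<le> \<delta>\<close> at most
  \<open>B * \<delta> powr \<gamma>\<close>. Two pairs \<open>(i, j)\<close>, \<open>(k, l)\<close> whose endpoints are not all close have an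
  exponentially small covariance, because one of them involves a long block of steps that the other
  one does not involve. Hence the second moments are summable along \<open>N = m ^ A\<close> for large \<open>A\<close>, and
  monotonicity of the pair count yields the limit along all \<open>N\<close>.\<close>

section \<open>Density of Borel sets in intervals\<close>

text \<open>The density of the steps may live on a set without interior, so a single step need not
  dominate Lebesgue measure on any interval. A set of positive measure nearly fills some interval,
  however, and the convolution of its indicator with itself is bounded below on a genuine interval;
  doubling the number of steps then stretches that interval by 3/2 until it covers a full period.
  All of this happens on the real line: the torus is never constructed, and reduction modulo 1
  enters only by testing laws against 1-periodic functions. Mixing says nothing about pairs whose
  indices are close. For these, (ii) only needs that the probability tends to 0 for each fixed
  number of steps, whereas the almost sure statement needs a rate, which p > 1 supplies. With N =
  m^A points and separation m, the factor \<theta>^m beats the m^(2A) left from counting couples of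
  pairs, while A \<gamma> \<ge> 4 makes the remaining terms of order at most m^(-2).\<close>

lemma cbox_minus_interior_null:
  fixes c d :: real
  shows "cbox c d - interior (cbox c d) \<in> null_sets lborel"
proof -
  have "cbox c d - interior (cbox c d) \<subseteq> {c, d}"
    by (auto simp: interior_cbox box_real)
  moreover have "{c, d} \<in> null_sets lborel"
    by (intro countable_imp_null_set_lborel) auto
  ultimately show ?thesis
    using null_sets_subset by (metis borel_closed borel_open closed_cbox open_interior sets.Diff sets_lborel)
qed

text \<open>A weak form of Lebesgue's density theorem, by covering. If \<open>E\<close> filled less
  than 9/10 of every interval, then non-overlapping intervals that cover a bounded part
  \<open>S\<close> of \<open>E\<close> inside an open set of measure at most 11/10 of that of
  \<open>S\<close> would leave \<open>S\<close> with at most 99/100 of its own measure.\<close>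

lemma dense_interval_exists:
  fixes E :: "real set"
  assumes E[measurable]: "E \<in> sets borel" and pos: "emeasure lborel E > 0"
  shows "\<exists>a l. l > 0 \<and> measure lborel (E \<inter> {a..a+l}) \<ge> 9/10 * l"
proof (rule ccontr)
  assume "\<not> ?thesis"
  then have small: "measure lborel (E \<inter> {a..a+l}) < 9/10 * l" if "l > 0" for a l
    using that by (meson not_le)
  have "\<exists>n::nat. emeasure lborel (E \<inter> box (-real n) (real n)) > 0"
  proof (rule ccontr)
    assume "\<not> ?thesis"
    then have "E \<inter> box (-real n) (real n) \<in> null_sets lborel" for n
      by (auto simp: null_sets_def)
    then have "(\<Union>n. E \<inter> box (-real n) (real n)) \<in> null_sets lborel"
      by (intro null_sets_UN) auto
    moreover have "(\<Union>n. E \<inter> box (-real n) (real n)) = E"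
      by (auto simp: box_real) (metis abs_less_iff minus_less_iff reals_Archimedean2)
    ultimately show False using pos by (auto simp: null_sets_def)
  qed
  then obtain n :: nat where n: "emeasure lborel (E \<inter> box (-real n) (real n)) > 0" by auto
  define S where "S = E \<inter> box (-real n) (real n)"
  have S[measurable]: "S \<in> sets borel" by (simp add: S_def)
  have "emeasure lborel S \<le> emeasure lborel (box (-real n) (real n))"
    unfolding S_def by (intro emeasure_mono) auto
  also have "\<dots> < \<infinity>" by (simp add: box_real)
  finally have Sfin: "emeasure lborel S < \<infinity>" .
  define m where "m = measure lborel S"
  have mS: "emeasure lborel S = ennreal m"
    using Sfin by (simp add: m_def emeasure_eq_ennreal_measure top.not_eq_extremum)
  have mpos: "m > 0" using n unfolding S_def[symmetric] mS by simp
  obtain V where V: "open V" "S \<subseteq> V" "emeasure lborel (V - S) < ennreal (m/10)"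
    using outer_regular_lborel[OF S, of "m/10"] mpos by auto
  have nbox: "box (-real n) (real n) \<noteq> {}" using n by (intro notI) simp
  have "\<exists>e>0. ball x e \<subseteq> V" if "x \<in> S" for x
    using V that by (meson open_contains_ball subsetD)
  then obtain e where e: "\<And>x. x \<in> S \<Longrightarrow> e x > 0 \<and> ball x (e x) \<subseteq> V" by metis
  \<comment> \<open>Each covering interval will lie in the ball around one of its points in
    \<open>S\<close>, hence in \<open>V\<close>. The radius 1 off \<open>S\<close> is an arbitrary
    choice that makes \<open>g\<close> a gauge on the whole line.\<close>
  define g where "g = (\<lambda>x. if x \<in> S then ball x (e x) else ball x 1)"
  have g: "gauge g" using e by (auto simp: gauge_def g_def)
  have Sbox: "S \<subseteq> cbox (-real n) (real n)" using box_subset_cbox by (auto simp: S_def)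
  obtain \<D> :: "real set set" where D: "countable \<D>" "\<Union>\<D> \<subseteq> cbox (-real n) (real n)"
    "\<And>K. K \<in> \<D> \<Longrightarrow> interior K \<noteq> {} \<and> (\<exists>c d. K = cbox c d)"
    "pairwise (\<lambda>A B. interior A \<inter> interior B = {}) \<D>"
    "\<And>K. K \<in> \<D> \<Longrightarrow> \<exists>x \<in> S \<inter> K. K \<subseteq> g x"
    "\<And>u v. cbox u v \<in> \<D> \<Longrightarrow> \<exists>n'. \<forall>i\<in>Basis. v \<bullet> i - u \<bullet> i = (real n \<bullet> i - (-real n) \<bullet> i) / 2 ^ n'"
    "S \<subseteq> \<Union>\<D>"
    apply (rule covering_lemma[OF Sbox nbox g])
    subgoal premises prems for \<D> by (rule prems(1)[OF prems(2-)])
    done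
  have KV: "K \<subseteq> V" if "K \<in> \<D>" for K
    using D(5)[OF that] e by (auto simp: g_def split: if_splits)
  have dj: "disjoint_family_on interior \<D>"
    using D(4) by (auto simp: disjoint_family_on_def pairwise_def)
  have dj': "disjoint_family_on (\<lambda>K. S \<inter> interior K) \<D>"
    using dj by (auto simp: disjoint_family_on_def)
  \<comment> \<open>The closed intervals may share endpoints. Up to this null set \<open>S\<close>
    is covered by their disjoint interiors, whose measures add.\<close>
  have null: "(\<Union>K\<in>\<D>. K - interior K) \<in> null_sets lborel"
    by (intro null_sets_UN' D(1)) (metis D(3) cbox_minus_interior_null)
  have bound: "emeasure lborel (S \<inter> interior K) \<le> ennreal (9/10) * emeasure lborel (interior K)"
    if K: "K \<in> \<D>" for K
  proof -
    obtain c d where cd: "K = cbox c d" "interior K \<noteq> {}" using D(3)[OF K] by auto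
    have cd': "c < d" using cd by (auto simp: interior_cbox box_real)
    have fin: "emeasure lborel (E \<inter> {c..d}) \<noteq> \<infinity>"
    proof -
      have "emeasure lborel (E \<inter> {c..d}) \<le> emeasure lborel {c..d}"
        by (intro emeasure_mono) auto
      then show ?thesis using cd' by (auto simp: top_unique)
    qed
    have "emeasure lborel (S \<inter> interior K) \<le> emeasure lborel (E \<inter> {c..d})"
      using cd(1) by (intro emeasure_mono) (auto simp: S_def interior_cbox box_real)
    also have "\<dots> = ennreal (measure lborel (E \<inter> {c..d}))"
      using fin by (simp add: emeasure_eq_ennreal_measure)
    also have "\<dots> \<le> ennreal (9/10 * (d - c))"
      using small[of "d-c" c] cd' by (intro ennreal_leI) auto
    also have "\<dots> = ennreal (9/10) * emeasure lborel (interior K)"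
    proof -
      have "emeasure lborel (interior K) = ennreal (d - c)"
        using cd cd' by (simp add: interior_cbox box_real)
      then show ?thesis using cd' by (simp only: ennreal_mult[symmetric])
    qed
    finally show ?thesis .
  qed
  have meas: "(\<Union>K\<in>\<D>. S \<inter> interior K) \<in> sets lborel"
    using D(1) by (intro sets.countable_UN') auto
  have "S \<subseteq> (\<Union>K\<in>\<D>. S \<inter> interior K) \<union> (\<Union>K\<in>\<D>. K - interior K)"
    using D(7) by auto
  then have "emeasure lborel S \<le> emeasure lborel ((\<Union>K\<in>\<D>. S \<inter> interior K) \<union> (\<Union>K\<in>\<D>. K - interior K))"
    using null meas by (intro emeasure_mono sets.Un) auto
  also have "\<dots> = emeasure lborel (\<Union>K\<in>\<D>. S \<inter> interior K)"
    using null meas by (intro emeasure_Un_null_set) auto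
  also have "\<dots> = (\<integral>\<^sup>+K. emeasure lborel (S \<inter> interior K) \<partial>count_space \<D>)"
    using D(1) dj' by (intro emeasure_UN_countable) auto
  also have "\<dots> \<le> (\<integral>\<^sup>+K. ennreal (9/10) * emeasure lborel (interior K) \<partial>count_space \<D>)"
    using bound by (intro nn_integral_mono) auto
  also have "\<dots> = ennreal (9/10) * (\<integral>\<^sup>+K. emeasure lborel (interior K) \<partial>count_space \<D>)"
    by (intro nn_integral_cmult) auto
  also have "(\<integral>\<^sup>+K. emeasure lborel (interior K) \<partial>count_space \<D>) = emeasure lborel (\<Union>K\<in>\<D>. interior K)"
    using D(1) dj by (intro emeasure_UN_countable[symmetric]) auto
  also have "\<dots> \<le> emeasure lborel V"
  proof (intro emeasure_mono)
    show "(\<Union>K\<in>\<D>. interior K) \<subseteq> V" using KV interior_subset by blast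
    show "V \<in> sets lborel" using V(1) by simp
  qed
  also have "emeasure lborel V = emeasure lborel S + emeasure lborel (V - S)"
    using V by (subst plus_emeasure) (auto intro: arg_cong[where f="emeasure lborel"])
  also have "\<dots> \<le> ennreal m + ennreal (m/10)"
    using V(3) mS by (intro add_mono) auto
  also have "ennreal m + ennreal (m/10) = ennreal (11/10*m)"
    using mpos by (subst ennreal_plus[symmetric]) auto
  finally have "ennreal m \<le> ennreal (9/10) * ennreal (11/10*m)"
    unfolding mS by (simp only: mult_left_mono zero_le)
  also have "\<dots> = ennreal (99/100*m)" using mpos by (subst ennreal_mult[symmetric]) auto
  finally show False using mpos by simp
qed

section \<open>Periodic functions\<close>

definition periodic1 :: "(real \<Rightarrow> 'a) \<Rightarrow> bool" where
  "periodic1 f \<longleftrightarrow> (\<forall>x. f (x + 1) = f x)"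

lemma periodic1_add_of_nat: "periodic1 f \<Longrightarrow> f (x + real n) = f x"
proof (induction n)
  case (Suc n)
  have "f (x + real (Suc n)) = f ((x + real n) + 1)" by (simp add: algebra_simps)
  also have "\<dots> = f x" using Suc by (simp add: periodic1_def)
  finally show ?case .
qed simp

lemma periodic1_add_of_int:
  assumes "periodic1 f" shows "f (x + of_int k) = f x"
proof (cases "k \<ge> 0")
  case True
  then show ?thesis using periodic1_add_of_nat[OF assms, of x "nat k"] by simp
next
  case False
  then show ?thesis using periodic1_add_of_nat[OF assms, of "x + of_int k" "nat (-k)"] by simp
qed

lemma periodic1_shift: "periodic1 f \<Longrightarrow> periodic1 (\<lambda>t. f (x + t))"
  by (auto simp: periodic1_def) (metis add.assoc)

lemma periodic1_eqI:
  assumes "periodic1 f" "x - y \<in> \<int>" shows "f x = f y"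
  using assms periodic1_add_of_int[OF assms(1), of y] by (auto elim!: Ints_cases)
     (metis add.commute diff_add_cancel)

lemma prob_space_unit: "prob_space lborel_unit"
  by (rule prob_spaceI) (simp add: emeasure_restrict_space space_restrict_space)

lemma nn_integral_unit:
  "f \<in> borel_measurable borel \<Longrightarrow>
     (\<integral>\<^sup>+t. f t \<partial>lborel_unit) = (\<integral>\<^sup>+t. f t * indicator {0..<1} t \<partial>lborel)"
  by (subst nn_integral_restrict_space) auto

lemma nn_integral_lborel_shift:
  fixes f :: "real \<Rightarrow> ennreal"
  assumes "f \<in> borel_measurable borel"
  shows "(\<integral>\<^sup>+t. f (x + t) \<partial>lborel) = (\<integral>\<^sup>+t. f t \<partial>lborel)"
  using nn_integral_real_affine[OF assms, of 1 x] by (simp add: one_ennreal_def[symmetric])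

lemma measurable_unit: "f \<in> borel_measurable borel \<Longrightarrow> f \<in> borel_measurable lborel_unit"
  by (intro measurable_restrict_space1) simp

text \<open>By periodicity the shift may be taken in [0,1). The shifted period [r, r+1) is cut at 1
  and its second piece is moved back by 1.\<close>

lemma nn_integral_unit_periodic_shift:
  fixes f :: "real \<Rightarrow> ennreal"
  assumes f[measurable]: "f \<in> borel_measurable borel" and per: "periodic1 f"
  shows "(\<integral>\<^sup>+t. f (x + t) \<partial>lborel_unit) = (\<integral>\<^sup>+t. f t \<partial>lborel_unit)"
proof -
  define r where "r = frac x"
  have r: "0 \<le> r" "r < 1" by (auto simp: r_def frac_lt_1)
  have "f (x + t) = f (r + t)" for t
    by (intro periodic1_eqI[OF per]) (auto simp: r_def frac_def)
  then have "(\<integral>\<^sup>+t. f (x + t) \<partial>lborel_unit) = (\<integral>\<^sup>+t. f (r + t) * indicator {r..<r+1} (r + t) \<partial>lborel)"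
    by (simp add: nn_integral_unit) (intro nn_integral_cong, auto simp: indicator_def)
  also have "\<dots> = (\<integral>\<^sup>+t. f t * indicator {r..<r+1} t \<partial>lborel)"
    by (intro nn_integral_lborel_shift[where f="\<lambda>t. f t * indicator {r..<r+1} t"]) auto
  also have "\<dots> = (\<integral>\<^sup>+t. f t * indicator {r..<1} t + f t * indicator {1..<r+1} t \<partial>lborel)"
    using r by (intro nn_integral_cong) (auto simp: indicator_def)
  also have "\<dots> = (\<integral>\<^sup>+t. f t * indicator {r..<1} t \<partial>lborel) + (\<integral>\<^sup>+t. f t * indicator {1..<r+1} t \<partial>lborel)"
    by (intro nn_integral_add) auto
  also have "(\<integral>\<^sup>+t. f t * indicator {1..<r+1} t \<partial>lborel) = (\<integral>\<^sup>+t. f (1 + t) * indicator {1..<r+1} (1 + t) \<partial>lborel)"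
    by (intro nn_integral_lborel_shift[where f="\<lambda>t. f t * indicator {1..<r+1} t", symmetric]) auto
  also have "\<dots> = (\<integral>\<^sup>+t. f t * indicator {0..<r} t \<partial>lborel)"
    using per by (intro nn_integral_cong) (auto simp: indicator_def periodic1_def add.commute)
  also have "(\<integral>\<^sup>+t. f t * indicator {r..<1} t \<partial>lborel) + \<dots> =
     (\<integral>\<^sup>+t. f t * indicator {r..<1} t + f t * indicator {0..<r} t \<partial>lborel)"
    by (intro nn_integral_add[symmetric]) auto
  also have "\<dots> = (\<integral>\<^sup>+t. f t * indicator {0..<1} t \<partial>lborel)"
    using r by (intro nn_integral_cong) (auto simp: indicator_def)
  finally show ?thesis by (simp add: nn_integral_unit)
qed

text \<open>Adding the bound \<open>B\<close> makes the integrand nonnegative, which reduces the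
  claim to the previous one.\<close>

lemma integral_unit_periodic_shift:
  fixes f :: "real \<Rightarrow> real"
  assumes f[measurable]: "f \<in> borel_measurable borel" and per: "periodic1 f"
    and bd: "\<And>x. \<bar>f x\<bar> \<le> B"
  shows "(\<integral>t. f (x + t) \<partial>lborel_unit) = (\<integral>t. f t \<partial>lborel_unit)"
proof -
  interpret U: prob_space lborel_unit by (rule prob_space_unit)
  have int: "integrable lborel_unit (\<lambda>t. f (y + t))" for y
    using bd by (intro U.integrable_const_bound[of _ B] AE_I2 measurable_unit) auto
  have nn: "(\<integral>t. f (y + t) + B \<partial>lborel_unit) = enn2real (\<integral>\<^sup>+t. ennreal (f (y + t) + B) \<partial>lborel_unit)" for y
  proof (intro integral_eq_nn_integral AE_I2)
    show "(\<lambda>t. f (y + t) + B) \<in> borel_measurable lborel_unit" by (intro measurable_unit) auto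
    show "0 \<le> f (y + t) + B" for t using bd[of "y + t"] by linarith
  qed
  have "(\<integral>\<^sup>+t. ennreal (f (x + t) + B) \<partial>lborel_unit) = (\<integral>\<^sup>+t. ennreal (f t + B) \<partial>lborel_unit)"
    using per by (intro nn_integral_unit_periodic_shift[where f="\<lambda>t. ennreal (f t + B)"]) (auto simp: periodic1_def)
  then have "(\<integral>t. f (x + t) + B \<partial>lborel_unit) = (\<integral>t. f t + B \<partial>lborel_unit)"
    using nn[of x] nn[of 0] by simp
  then show ?thesis
    using int[of x] int[of 0] by simp
qed

section \<open>Convolution powers\<close>

text \<open>The law of a sum of \<open>n\<close> steps as a law on the real line, without reduction
  modulo 1.\<close>

primrec conv_pow :: "real measure \<Rightarrow> nat \<Rightarrow> real measure" where
  "conv_pow K 0 = return borel 0"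
| "conv_pow K (Suc n) = convolution K (conv_pow K n)"

lemma prob_space_convolution:
  fixes A B :: "real measure"
  assumes "prob_space A" "prob_space B" "sets A = sets borel" "sets B = sets borel"
  shows "prob_space (convolution A B)"
proof -
  interpret A: prob_space A by fact
  interpret B: prob_space B by fact
  interpret pair_prob_space A B ..
  have [measurable_cong]: "sets A = sets borel" "sets B = sets borel" by fact+
  show ?thesis unfolding convolution_def by (intro prob_space_distr) auto
qed

lemma integral_convolution:
  fixes A B :: "real measure" and f :: "real \<Rightarrow> real"
  assumes "prob_space A" "prob_space B"
    and [measurable_cong]: "sets A = sets borel" "sets B = sets borel"
    and [measurable]: "f \<in> borel_measurable borel" and bd: "\<And>x. \<bar>f x\<bar> \<le> C"
  shows "(\<integral>x. f x \<partial>(convolution A B)) = (\<integral>x. \<integral>y. f (x + y) \<partial>B \<partial>A)"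
proof -
  interpret A: prob_space A by fact
  interpret B: prob_space B by fact
  interpret pair_prob_space A B ..
  have "(\<integral>x. f x \<partial>(convolution A B)) = (\<integral>z. f (fst z + snd z) \<partial>(A \<Otimes>\<^sub>M B))"
    unfolding convolution_def by (subst integral_distr) (auto simp: case_prod_beta)
  also have "\<dots> = (\<integral>x. \<integral>y. f (x + y) \<partial>B \<partial>A)"
    using bd by (subst integral_fst'[symmetric]) (auto intro!: integrable_const_bound[of _ C])
  finally show ?thesis .
qed

locale borel_prob = prob_space K for K :: "real measure" +
  assumes sets_K[measurable_cong]: "sets K = sets borel"
begin

lemma sets_conv_pow[simp, measurable_cong]: "sets (conv_pow K n) = sets borel"
  by (cases n) auto

lemma prob_space_conv_pow: "prob_space (conv_pow K n)"
  by (induction n) (auto intro!: prob_space_return prob_space_convolution sets_K prob_space_axioms)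

lemma conv_pow_add: "conv_pow K (m + n) = convolution (conv_pow K m) (conv_pow K n)"
proof (induction m)
  case 0
  have "emeasure (convolution (return borel 0) (conv_pow K n)) A = (\<integral>\<^sup>+x. indicator A x \<partial>conv_pow K n)"
    if A[measurable]: "A \<in> sets borel" for A
  proof -
    interpret C: prob_space "conv_pow K n" by (rule prob_space_conv_pow)
    have "emeasure (convolution (return borel 0) (conv_pow K n)) A =
        (\<integral>\<^sup>+x. \<integral>\<^sup>+y. indicator A (x + y) \<partial>conv_pow K n \<partial>return borel 0)"
      by (intro convolution_emeasure') (auto simp: prob_space.finite_measure prob_space_return C.finite_measure_axioms)
    also have "\<dots> = (\<integral>\<^sup>+y. indicator A (0 + y) \<partial>conv_pow K n)"
      by (subst nn_integral_return) auto
    finally show ?thesis by simp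
  qed
  then show ?case by (intro measure_eqI) auto
next
  case (Suc m)
  then show ?case
    using prob_space.finite_measure[OF prob_space_conv_pow] finite_measure_axioms
    by (simp add: convolution_associative sets_K)
qed

lemma nn_integral_conv_pow_add:
  assumes [measurable]: "f \<in> borel_measurable borel"
  shows "(\<integral>\<^sup>+x. f x \<partial>conv_pow K (m + n)) = (\<integral>\<^sup>+x. \<integral>\<^sup>+y. f (x + y) \<partial>conv_pow K n \<partial>conv_pow K m)"
  unfolding conv_pow_add
  by (rule nn_integral_convolution) (auto simp: prob_space.finite_measure prob_space_conv_pow)

lemma integral_conv_pow_add:
  fixes f :: "real \<Rightarrow> real"
  assumes [measurable]: "f \<in> borel_measurable borel" and bd: "\<And>x. \<bar>f x\<bar> \<le> C"
  shows "(\<integral>x. f x \<partial>conv_pow K (m + n)) = (\<integral>x. \<integral>y. f (x + y) \<partial>conv_pow K n \<partial>conv_pow K m)"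
  unfolding conv_pow_add
  by (rule integral_convolution[where C=C]) (auto simp: prob_space_conv_pow bd)

lemma conv_pow_1: "conv_pow K 1 = K"
proof -
  have "emeasure (convolution K (return borel 0)) A = emeasure K A" if A[measurable]: "A \<in> sets borel" for A
  proof -
    have "emeasure (convolution K (return borel 0)) A =
        (\<integral>\<^sup>+x. \<integral>\<^sup>+y. indicator A (x + y) \<partial>return borel 0 \<partial>K)"
      by (intro convolution_emeasure') (auto simp: prob_space.finite_measure prob_space_return finite_measure_axioms sets_K)
    also have "\<dots> = (\<integral>\<^sup>+x. indicator A (x + 0) \<partial>K)"
      by (intro nn_integral_cong nn_integral_return) auto
    finally show ?thesis by (simp add: sets_K)
  qed
  then show ?thesis by (intro measure_eqI) (auto simp: sets_K)
qed

end

section \<open>Geometric ergodicity\<close>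

text \<open>The integral is the convolution of \<open>indicator E\<close> with itself at
  \<open>r\<close>, that is, the measure of the intersection of \<open>E\<close> with its reflection
  \<open>r - E\<close>. Both sets have measure at least 9/10 * l, and the bound on \<open>r\<close>
  places them in a common interval of length at most 7/4 * l, so they overlap in at least (18/10 -
  7/4) * l = l / 20.\<close>

lemma measure_inter_reflection:
  fixes E :: "real set"
  assumes E[measurable]: "E \<in> sets borel" and sub: "E \<subseteq> {a..a+l}" and big: "9/10 * l \<le> measure lborel E"
    and r: "\<bar>r - (2 * a + l)\<bar> \<le> 3/4 * l"
  shows "ennreal (l / 20) \<le> (\<integral>\<^sup>+t. indicator E t * indicator E (r - t) \<partial>lborel)"
proof -
  define E' where "E' = (\<lambda>t. r - t) -` E"
  have E'[measurable]: "E' \<in> sets borel" unfolding E'_def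
    using measurable_sets[of "\<lambda>t. r - t" borel borel E] E by (auto)
  have l: "0 \<le> l" using r by linarith
  have eE': "emeasure lborel E' = emeasure lborel E"
  proof -
    have "emeasure lborel E = (\<integral>\<^sup>+t. indicator E t \<partial>lborel)" by simp
    also have "\<dots> = (\<integral>\<^sup>+t. indicator E (r + (-1) * t) \<partial>lborel)"
      by (subst nn_integral_real_affine[of _ "-1" r]) (auto simp: one_ennreal_def[symmetric])
    also have "\<dots> = (\<integral>\<^sup>+t. indicator E' t \<partial>lborel)"
      by (intro nn_integral_cong) (auto simp: E'_def split: split_indicator)
    finally show ?thesis by simp
  qed
  define I where "I = {min a (r - a - l)..max (a + l) (r - a)}"
  have sub': "E \<union> E' \<subseteq> I" using sub by (auto simp: E'_def I_def) (force)+
  have "bounded I" by (simp add: I_def)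
  then have finI: "emeasure lborel I < \<infinity>" by (rule emeasure_bounded_finite)
  have lenI: "measure lborel I \<le> 7/4 * l"
    using r l by (simp add: I_def min_def max_def abs_if split: if_splits)
  have fin: "emeasure lborel A \<noteq> \<infinity>" if "A \<subseteq> I" "A \<in> sets borel" for A
  proof -
    have "emeasure lborel A \<le> emeasure lborel I" using that by (intro emeasure_mono) (auto simp: I_def)
    also have "\<dots> < \<infinity>" by (rule finI)
    finally show ?thesis by simp
  qed
  have mE': "measure lborel E' = measure lborel E" using eE' by (simp add: measure_def)
  have fm: "E \<in> fmeasurable lborel" "E' \<in> fmeasurable lborel"
    using fin[of E] fin[of E'] sub' by (auto intro!: fmeasurableI simp: less_top)
  have "measure lborel (E \<union> E') \<le> measure lborel I"
    using sub' finI by (intro measure_mono_fmeasurable fmeasurableI) (auto simp: I_def)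
  moreover have "measure lborel (E \<union> E') = measure lborel E + measure lborel E' - measure lborel (E \<inter> E')"
    using measure_Un3[OF fm] by simp
  ultimately have "l / 20 \<le> measure lborel (E \<inter> E')" using lenI big mE' l by linarith
  then have "ennreal (l / 20) \<le> ennreal (measure lborel (E \<inter> E'))" by (rule ennreal_leI)
  also have "\<dots> = emeasure lborel (E \<inter> E')"
    using fin[of "E \<inter> E'"] sub' by (intro emeasure_eq_ennreal_measure[symmetric]) auto
  also have "\<dots> = (\<integral>\<^sup>+t. indicator (E \<inter> E') t \<partial>lborel)" by simp
  also have "\<dots> = (\<integral>\<^sup>+t. indicator E t * indicator E (r - t) \<partial>lborel)"
    by (intro nn_integral_cong) (auto simp: E'_def split: split_indicator)
  finally show ?thesis .
qed

context borel_prob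
begin

text \<open>Domination of \<open>c\<close> times Lebesgue measure on \<open>E\<close> by the law of
  \<open>m\<close> steps. The form with test functions can be applied directly to the inner and the
  outer integral of a convolution.\<close>

definition minorizes :: "nat \<Rightarrow> real \<Rightarrow> real set \<Rightarrow> bool" where
  "minorizes m c E \<longleftrightarrow> (\<forall>\<phi>\<in>borel_measurable borel.
     ennreal c * (\<integral>\<^sup>+t. \<phi> t * indicator E t \<partial>lborel) \<le> (\<integral>\<^sup>+t. \<phi> t \<partial>conv_pow K m))"

text \<open>Nine tenths suffice for the convolution of \<open>indicator E\<close> with itself to be bounded below on
  an interval longer by the factor \<open>3/2\<close>.\<close>

lemma minorizes_grow:
  assumes l: "0 < l" and c: "0 < c" and E[measurable]: "E \<in> sets borel"
    and sub: "E \<subseteq> {a..a+l}" and big: "9/10 * l \<le> measure lborel E" and min: "minorizes m c E"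
  shows "minorizes (m + m) (c * c * (l / 20)) {(2 * a + l / 4)..(2 * a + l / 4) + 3/2 * l}"
proof -
  have dom: "\<And>\<phi>. \<phi> \<in> borel_measurable borel \<Longrightarrow>
        ennreal c * (\<integral>\<^sup>+t. \<phi> t * indicator E t \<partial>lborel) \<le> (\<integral>\<^sup>+t. \<phi> t \<partial>conv_pow K m)"
    using min unfolding minorizes_def by blast
  define I where "I = {(2 * a + l / 4)..(2 * a + l / 4) + 3/2 * l}"
  have "ennreal (c * c * (l / 20)) * (\<integral>\<^sup>+t. \<phi> t * indicator I t \<partial>lborel) \<le> (\<integral>\<^sup>+t. \<phi> t \<partial>conv_pow K (m + m))"
    if \<phi>[measurable]: "\<phi> \<in> borel_measurable borel" for \<phi>
  proof -
    interpret C: prob_space "conv_pow K m" by (rule prob_space_conv_pow)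
    \<comment> \<open>\<open>I\<close> is the interval with centre \<open>2 * a + l\<close> and
      radius \<open>3/4 * l\<close>, exactly the range allowed for \<open>r\<close> in
      \<open>measure_inter_reflection\<close>.\<close>
    have pt: "\<phi> r * (ennreal (l / 20) * indicator I r) \<le> \<phi> r * (\<integral>\<^sup>+t. indicator E t * indicator E (r - t) \<partial>lborel)" for r
    proof (cases "r \<in> I")
      case True
      then have "\<bar>r - (2 * a + l)\<bar> \<le> 3/4 * l" by (unfold I_def, simp only: atLeastAtMost_iff, linarith)
      from measure_inter_reflection[OF E sub big this] True show ?thesis
        by (intro mult_left_mono) auto
    qed auto
    have "ennreal (c * c * (l / 20)) * (\<integral>\<^sup>+t. \<phi> t * indicator I t \<partial>lborel)
      = ennreal c * (ennreal c * (\<integral>\<^sup>+r. \<phi> r * (ennreal (l / 20) * indicator I r) \<partial>lborel))"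
    proof -
      have "(\<integral>\<^sup>+r. \<phi> r * (ennreal (l / 20) * indicator I r) \<partial>lborel) = ennreal (l / 20) * (\<integral>\<^sup>+t. \<phi> t * indicator I t \<partial>lborel)"
        by (subst nn_integral_cmult[symmetric]) (auto simp: I_def mult_ac)
      moreover have "ennreal (c * c * (l / 20)) = ennreal c * ennreal c * ennreal (l / 20)"
        using c l by (subst ennreal_mult, auto)+
      ultimately show ?thesis by (simp only: mult.assoc)
    qed
    also have "\<dots> \<le> ennreal c * (ennreal c * (\<integral>\<^sup>+r. \<phi> r * (\<integral>\<^sup>+t. indicator E t * indicator E (r - t) \<partial>lborel) \<partial>lborel))"
      by (intro mult_left_mono nn_integral_mono pt) auto
    also have "(\<integral>\<^sup>+r. \<phi> r * (\<integral>\<^sup>+t. indicator E t * indicator E (r - t) \<partial>lborel) \<partial>lborel)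
      = (\<integral>\<^sup>+r. \<integral>\<^sup>+t. \<phi> r * (indicator E t * indicator E (r - t)) \<partial>lborel \<partial>lborel)"
      by (intro nn_integral_cong nn_integral_cmult[symmetric]) auto
    also have "\<dots> = (\<integral>\<^sup>+t. \<integral>\<^sup>+r. \<phi> r * (indicator E t * indicator E (r - t)) \<partial>lborel \<partial>lborel)"
      by (intro lborel_pair.Fubini') auto
    also have "\<dots> = (\<integral>\<^sup>+t. \<integral>\<^sup>+r. \<phi> (t + r) * (indicator E t * indicator E r) \<partial>lborel \<partial>lborel)"
    proof (rule nn_integral_cong)
      fix t :: real
      show "(\<integral>\<^sup>+r. \<phi> r * (indicator E t * indicator E (r - t)) \<partial>lborel)
        = (\<integral>\<^sup>+r. \<phi> (t + r) * (indicator E t * indicator E r) \<partial>lborel)"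
        using nn_integral_lborel_shift[of "\<lambda>r. \<phi> r * (indicator E t * indicator E (r - t))" t] by simp
    qed
    also have "\<dots> = (\<integral>\<^sup>+t. (\<integral>\<^sup>+r. \<phi> (t + r) * indicator E r \<partial>lborel) * indicator E t \<partial>lborel)"
    proof (rule nn_integral_cong)
      fix t :: real
      show "(\<integral>\<^sup>+r. \<phi> (t + r) * (indicator E t * indicator E r) \<partial>lborel)
         = (\<integral>\<^sup>+r. \<phi> (t + r) * indicator E r \<partial>lborel) * indicator E t"
        by (subst nn_integral_multc[symmetric]) (auto simp: mult_ac)
    qed
    also have "ennreal c * \<dots> = (\<integral>\<^sup>+t. (ennreal c * (\<integral>\<^sup>+r. \<phi> (t + r) * indicator E r \<partial>lborel)) * indicator E t \<partial>lborel)"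
      by (subst nn_integral_cmult[symmetric]) (auto simp: mult_ac)
    \<comment> \<open>After Fubini and a shift the integral runs over two independent points of
      \<open>E\<close>. The minorization is applied twice, here for fixed \<open>t\<close> to the
      inner point and then to the outer one.\<close>
    also have "\<dots> \<le> (\<integral>\<^sup>+t. (\<integral>\<^sup>+r. \<phi> (t + r) \<partial>conv_pow K m) * indicator E t \<partial>lborel)"
      by (intro nn_integral_mono mult_right_mono dom) auto
    also have "ennreal c * \<dots> \<le> (\<integral>\<^sup>+t. \<integral>\<^sup>+r. \<phi> (t + r) \<partial>conv_pow K m \<partial>conv_pow K m)"
      by (intro dom) measurable
    also have "\<dots> = (\<integral>\<^sup>+t. \<phi> t \<partial>conv_pow K (m + m))"
      by (rule nn_integral_conv_pow_add[symmetric]) auto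
    finally show ?thesis by (simp add: mult_left_mono)
  qed
  then show ?thesis unfolding minorizes_def I_def by blast
qed

end

locale ac_law = borel_prob +
  fixes F :: "real \<Rightarrow> ennreal"
  assumes F[measurable]: "F \<in> borel_measurable borel" and K_density: "K = density lborel F"
begin

text \<open>Since \<open>F\<close> has integral 1, it exceeds some positive level on a set of
  positive measure. That set nearly fills an interval, and one convolution turns it into an
  interval.\<close>

lemma minorizes_start:
  "\<exists>m c a l. 1 \<le> m \<and> 0 < c \<and> 0 < l \<and> minorizes m c {a..a+l}"
proof -
  have "\<exists>n. emeasure lborel {t. ennreal (1 / real (Suc n)) \<le> F t} > 0"
  proof (rule ccontr)
    assume "\<not> ?thesis"
    then have "{t. ennreal (1 / real (Suc n)) \<le> F t} \<in> null_sets lborel" for n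
      by (auto simp: null_sets_def)
    then have null: "(\<Union>n. {t. ennreal (1 / real (Suc n)) \<le> F t}) \<in> null_sets lborel"
      by (intro null_sets_UN) auto
    have "F t = 0" if "t \<notin> (\<Union>n. {t. ennreal (1 / real (Suc n)) \<le> F t})" for t
    proof (rule ccontr)
      assume "F t \<noteq> 0"
      have "\<exists>r>0. ennreal r \<le> F t"
      proof (cases "F t")
        case (real r)
        then show ?thesis using \<open>F t \<noteq> 0\<close> by (intro exI[of _ r]) (auto simp: less_le)
      next
        case top
        then show ?thesis by (intro exI[of _ 1]) auto
      qed
      then obtain r where "r > 0" "ennreal r \<le> F t" by auto
      moreover obtain n where "1 / real (Suc n) < r"
        using \<open>r > 0\<close> reals_Archimedean[of r] by (auto simp: inverse_eq_divide)
      ultimately have "ennreal (1 / real (Suc n)) \<le> F t"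
        by (meson ennreal_leI less_imp_le order_trans)
      then show False using that by auto
    qed
    then have "AE t in lborel. F t = 0"
      using null by (intro AE_I'[OF null]) auto
    then have "(\<integral>\<^sup>+t. F t \<partial>lborel) = (\<integral>\<^sup>+t. 0 \<partial>(lborel::real measure))"
      by (intro nn_integral_cong_AE) auto
    moreover have "(\<integral>\<^sup>+t. F t \<partial>lborel) = 1"
      using emeasure_space_1 by (simp add: K_density emeasure_density)
    ultimately show False by simp
  qed
  then obtain n where n: "emeasure lborel {t. ennreal (1 / real (Suc n)) \<le> F t} > 0" by auto
  define c where "c = 1 / real (Suc n)"
  define E0 where "E0 = {t. ennreal c \<le> F t}"
  have E0[measurable]: "E0 \<in> sets borel" by (simp add: E0_def)
  obtain a l where l: "l > 0" "9/10 * l \<le> measure lborel (E0 \<inter> {a..a+l})"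
    using dense_interval_exists[OF E0] n by (auto simp: E0_def c_def)
  have "ennreal c * (\<integral>\<^sup>+t. \<phi> t * indicator (E0 \<inter> {a..a+l}) t \<partial>lborel) \<le> (\<integral>\<^sup>+t. \<phi> t \<partial>conv_pow K 1)"
    if [measurable]: "\<phi> \<in> borel_measurable borel" for \<phi>
  proof -
    have "ennreal c * (\<integral>\<^sup>+t. \<phi> t * indicator (E0 \<inter> {a..a+l}) t \<partial>lborel)
      = (\<integral>\<^sup>+t. ennreal c * (\<phi> t * indicator (E0 \<inter> {a..a+l}) t) \<partial>lborel)"
      by (intro nn_integral_cmult[symmetric]) auto
    also have "\<dots> \<le> (\<integral>\<^sup>+t. F t * \<phi> t \<partial>lborel)"
      by (intro nn_integral_mono) (auto simp: E0_def mult_right_mono split: split_indicator)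
    also have "\<dots> = (\<integral>\<^sup>+t. \<phi> t \<partial>K)" by (simp add: K_density nn_integral_density)
    finally show ?thesis by (simp only: conv_pow_1)
  qed
  then have "minorizes 1 c (E0 \<inter> {a..a+l})" unfolding minorizes_def by blast
  then have "minorizes (1 + 1) (c * c * (l / 20)) {(2 * a + l / 4)..(2 * a + l / 4) + 3/2 * l}"
    using l by (intro minorizes_grow[of l c "E0 \<inter> {a..a+l}"]) (auto simp: c_def)
  moreover have "1 \<le> (1 + 1 :: nat)" "0 < c * c * (l / 20)" "0 < 3/2 * l" using l by (auto simp: c_def)
  ultimately show ?thesis by blast
qed

lemma minorizes_double:
  assumes "0 < c" "0 < l" "minorizes m c {a..a+l}"
  shows "\<exists>c'>0. minorizes (m + m) c' {(2 * a + l / 4)..(2 * a + l / 4) + 3/2 * l}"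
proof -
  have "minorizes (m + m) (c * c * (l / 20)) {(2 * a + l / 4)..(2 * a + l / 4) + 3/2 * l}"
    using assms by (intro minorizes_grow[of l c "{a..a+l}"]) auto
  moreover have "0 < c * c * (l / 20)" using assms by auto
  ultimately show ?thesis by blast
qed

text \<open>Every doubling of the number of steps multiplies the length by 3/2. Length 1 is the goal
  because such an interval contains a full period.\<close>

lemma minorizes_long:
  "\<exists>m c a l. 1 \<le> m \<and> 0 < c \<and> 1 \<le> l \<and> minorizes m c {a..a+l}"
proof -
  obtain m0 c0 a0 l where l: "1 \<le> m0" "0 < c0" "0 < l" "minorizes m0 c0 {a0..a0+l}"
    using minorizes_start by blast
  have *: "\<exists>m c a. 1 \<le> m \<and> 0 < c \<and> minorizes m c {a..a+(3/2)^n * l}" for n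
  proof (induction n)
    case 0
    then show ?case using l by (intro exI[of _ m0] exI[of _ c0] exI[of _ a0]) auto
  next
    case (Suc n)
    then obtain m c a where mca: "1 \<le> m" "0 < c" "minorizes m c {a..a+(3/2)^n * l}" by blast
    obtain c' where "0 < c'"
      "minorizes (m + m) c' {(2 * a + (3/2)^n * l / 4)..(2 * a + (3/2)^n * l / 4) + 3/2 * ((3/2)^n * l)}"
      using minorizes_double[OF mca(2) _ mca(3)] l by auto
    moreover have "1 \<le> m + m" using mca by auto
    ultimately show ?case by (metis mult.assoc power_Suc)
  qed
  obtain n where "1 / l < (3/2)^n" using real_arch_pow[of "3/2" "1/l"] by auto
  then have "1 \<le> (3/2)^n * l" using l by (simp add: field_simps)
  then show ?thesis using * by blast
qed

text \<open>Doeblin's condition on the torus: for a periodic test function, the integral over one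
  period does not depend on where the period starts, so it may be placed inside the interval found
  above.\<close>

lemma doeblin:
  "\<exists>m c. 1 \<le> m \<and> 0 < c \<and> (\<forall>\<phi>\<in>borel_measurable borel. periodic1 \<phi> \<longrightarrow>
     ennreal c * (\<integral>\<^sup>+t. \<phi> t \<partial>lborel_unit) \<le> (\<integral>\<^sup>+t. \<phi> t \<partial>conv_pow K m))"
proof -
  obtain m c a l where l: "1 \<le> m" "0 < c" "1 \<le> l" "minorizes m c {a..a+l}"
    using minorizes_long by blast
  have "ennreal c * (\<integral>\<^sup>+t. \<phi> t \<partial>lborel_unit) \<le> (\<integral>\<^sup>+t. \<phi> t \<partial>conv_pow K m)"
    if \<phi>[measurable]: "\<phi> \<in> borel_measurable borel" and per: "periodic1 \<phi>" for \<phi>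
  proof -
    have "(\<integral>\<^sup>+t. \<phi> t \<partial>lborel_unit) = (\<integral>\<^sup>+t. \<phi> (a + t) \<partial>lborel_unit)"
      using nn_integral_unit_periodic_shift[OF \<phi> per] by simp
    also have "\<dots> \<le> (\<integral>\<^sup>+t. \<phi> (a + t) * indicator {a..a+l} (a + t) \<partial>lborel)"
      using l by (subst nn_integral_unit) (auto intro!: nn_integral_mono split: split_indicator)
    also have "\<dots> = (\<integral>\<^sup>+t. \<phi> t * indicator {a..a+l} t \<partial>lborel)"
      by (intro nn_integral_lborel_shift[where f="\<lambda>t. \<phi> t * indicator {a..a+l} t"]) auto
    finally have "ennreal c * (\<integral>\<^sup>+t. \<phi> t \<partial>lborel_unit) \<le> ennreal c * (\<integral>\<^sup>+t. \<phi> t * indicator {a..a+l} t \<partial>lborel)"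
      by (rule mult_left_mono) auto
    also have "\<dots> \<le> (\<integral>\<^sup>+t. \<phi> t \<partial>conv_pow K m)"
      using l(4) unfolding minorizes_def by auto
    finally show ?thesis .
  qed
  then show ?thesis using l by blast
qed

text \<open>A share \<open>c\<close> of the law is uniform and contributes nothing to a function of
  mean 0; the remaining mass is \<open>1 - c\<close>. Technically, the minorization is applied to
  the nonnegative function \<phi> + r, and then to -\<phi> in place of \<phi>.\<close>

lemma contraction:
  "\<exists>m c. 1 \<le> m \<and> 0 < c \<and> c < 1 \<and> (\<forall>\<phi>\<in>borel_measurable borel. \<forall>r x. periodic1 \<phi> \<longrightarrow> (\<forall>x. \<bar>\<phi> x :: real\<bar> \<le> r) \<longrightarrow>
     (\<integral>t. \<phi> t \<partial>lborel_unit) = 0 \<longrightarrow> \<bar>\<integral>t. \<phi> (x + t) \<partial>conv_pow K m\<bar> \<le> (1 - c) * r)"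
proof -
  obtain m c0 where mc: "1 \<le> m" "0 < c0" and
    D: "\<And>\<phi>. \<phi> \<in> borel_measurable borel \<Longrightarrow> periodic1 \<phi> \<Longrightarrow>
     ennreal c0 * (\<integral>\<^sup>+t. \<phi> t \<partial>lborel_unit) \<le> (\<integral>\<^sup>+t. \<phi> t \<partial>conv_pow K m)"
    using doeblin by blast
  \<comment> \<open>The cap 1/2 keeps \<open>1 - c\<close> positive, so that its \<open>m\<close>-th
    root can serve as a rate in (0,1).\<close>
  define c where "c = min c0 (1/2)"
  have c: "0 < c" "c < 1" using mc by (auto simp: c_def)
  interpret C: prob_space "conv_pow K m" by (rule prob_space_conv_pow)
  interpret U: prob_space lborel_unit by (rule prob_space_unit)
  have lower: "- ((1 - c) * r) \<le> (\<integral>t. \<phi> (x + t) \<partial>conv_pow K m)"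
    if \<phi>[measurable]: "\<phi> \<in> borel_measurable borel" and per: "periodic1 \<phi>" and bd: "\<And>x. \<bar>\<phi> x :: real\<bar> \<le> r"
      and mean: "(\<integral>t. \<phi> t \<partial>lborel_unit) = 0" for \<phi> r x
  proof -
    have r: "0 \<le> r" using bd[of 0] by linarith
    have nonneg: "0 \<le> \<phi> t + r" for t using bd[of t] by linarith
    have iU: "integrable lborel_unit (\<lambda>t. \<phi> t)"
      using bd by (intro U.integrable_const_bound[of _ r] AE_I2 measurable_unit) auto
    have iUx: "integrable lborel_unit (\<lambda>t. \<phi> (x + t))"
      using bd by (intro U.integrable_const_bound[of _ r] AE_I2 measurable_unit) auto
    have iC: "integrable (conv_pow K m) (\<lambda>t. \<phi> (x + t))"
      using bd by (intro C.integrable_const_bound[of _ r] AE_I2) auto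
    have "ennreal (c * r) \<le> ennreal c0 * ennreal r"
      using r c mc(2) by (subst ennreal_mult[symmetric]) (auto simp: c_def intro!: ennreal_leI mult_right_mono)
    also have "ennreal r = ennreal (\<integral>t. \<phi> (x + t) + r \<partial>lborel_unit)"
      using integral_unit_periodic_shift[OF \<phi> per bd, of x] mean iUx U.prob_space by simp
    also have "\<dots> = (\<integral>\<^sup>+t. ennreal (\<phi> (x + t) + r) \<partial>lborel_unit)"
      using iUx nonneg by (intro nn_integral_eq_integral[symmetric]) auto
    also have "ennreal c0 * \<dots> \<le> (\<integral>\<^sup>+t. ennreal (\<phi> (x + t) + r) \<partial>conv_pow K m)"
      using periodic1_shift[OF per, of x] by (intro D) (auto simp: periodic1_def)
    also have "\<dots> = ennreal (\<integral>t. \<phi> (x + t) + r \<partial>conv_pow K m)"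
      using iC nonneg by (intro nn_integral_eq_integral) auto
    also have "(\<integral>t. \<phi> (x + t) + r \<partial>conv_pow K m) = (\<integral>t. \<phi> (x + t) \<partial>conv_pow K m) + r"
      using iC C.prob_space by simp
    finally have *: "ennreal (c * r) \<le> ennreal ((\<integral>t. \<phi> (x + t) \<partial>conv_pow K m) + r)" .
    have "0 \<le> (\<integral>t. \<phi> (x + t) + r \<partial>conv_pow K m)" by (intro Bochner_Integration.integral_nonneg nonneg)
    then have "0 \<le> (\<integral>t. \<phi> (x + t) \<partial>conv_pow K m) + r"
      using iC C.prob_space by simp
    with * have "c * r \<le> (\<integral>t. \<phi> (x + t) \<partial>conv_pow K m) + r" by (simp add: ennreal_le_iff)
    then show ?thesis by (simp add: algebra_simps)
  qed
  have "\<bar>\<integral>t. \<phi> (x + t) \<partial>conv_pow K m\<bar> \<le> (1 - c) * r"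
    if "\<phi> \<in> borel_measurable borel" "periodic1 \<phi>" "\<And>x. \<bar>\<phi> x :: real\<bar> \<le> r"
      "(\<integral>t. \<phi> t \<partial>lborel_unit) = 0" for \<phi> r x
    using lower[OF that, of x] lower[of "\<lambda>x. - \<phi> x" r x] that by (auto simp: periodic1_def)
  then show ?thesis using mc c by blast
qed

text \<open>The contraction is applied once per block of \<open>m\<close> steps; the
  \<open>n mod m\<close> steps left over are averages and do not increase the bound.\<close>

lemma geometric_ergodicity:
  "\<exists>C \<theta>. 0 < C \<and> 0 < \<theta> \<and> \<theta> < 1 \<and> (\<forall>\<phi>\<in>borel_measurable borel. \<forall>n x. periodic1 \<phi> \<longrightarrow> (\<forall>x. \<bar>\<phi> x :: real\<bar> \<le> 1) \<longrightarrow>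
     (\<integral>t. \<phi> t \<partial>lborel_unit) = 0 \<longrightarrow> \<bar>\<integral>t. \<phi> (x + t) \<partial>conv_pow K n\<bar> \<le> C * \<theta> ^ n)"
proof -
  obtain m c where mc: "1 \<le> m" "0 < c" "c < 1" and
    con: "\<And>\<phi> r x. \<phi> \<in> borel_measurable borel \<Longrightarrow> periodic1 \<phi> \<Longrightarrow> (\<And>x. \<bar>\<phi> x :: real\<bar> \<le> r) \<Longrightarrow>
     (\<integral>t. \<phi> t \<partial>lborel_unit) = 0 \<Longrightarrow> \<bar>\<integral>t. \<phi> (x + t) \<partial>conv_pow K m\<bar> \<le> (1 - c) * r"
    using contraction by blast
  interpret U: prob_space lborel_unit by (rule prob_space_unit)
  have iter: "\<bar>\<integral>t. \<phi> (x + t) \<partial>conv_pow K (j * m + i)\<bar> \<le> (1 - c) ^ j"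
    if "\<phi> \<in> borel_measurable borel" "periodic1 \<phi>" "\<And>x. \<bar>\<phi> x :: real\<bar> \<le> 1"
      "(\<integral>t. \<phi> t \<partial>lborel_unit) = 0" for \<phi> x i j
    using that
  proof (induction j arbitrary: x)
    case 0
    interpret C: prob_space "conv_pow K i" by (rule prob_space_conv_pow)
    have "\<bar>\<integral>t. \<phi> (x + t) \<partial>conv_pow K i\<bar> \<le> (\<integral>t. \<bar>\<phi> (x + t)\<bar> \<partial>conv_pow K i)"
      by (rule integral_abs_bound)
    also have "\<dots> \<le> 1" using 0 by (intro C.integral_le_const C.integrable_const_bound[of _ 1] AE_I2) auto
    finally show ?case by simp
  next
    case (Suc j)
    let ?n = "j * m + i"
    interpret C: prob_space "conv_pow K ?n" by (rule prob_space_conv_pow)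
    interpret P: pair_prob_space lborel_unit "conv_pow K ?n" ..
    note [measurable] = Suc.prems(1)
    note bd = Suc.prems(3)
    \<comment> \<open>Averaging over the later steps gives a function that is again periodic and, as
      the uniform law is invariant under shifts, again has mean 0. By the induction hypothesis it is
      bounded by \<open>(1 - c) ^ j\<close>, so one more contraction applies.\<close>
    define \<psi> where "\<psi> = (\<lambda>x. \<integral>t. \<phi> (x + t) \<partial>conv_pow K ?n)"
    have \<psi>m[measurable]: "\<psi> \<in> borel_measurable borel" unfolding \<psi>_def by measurable
    have \<psi>p: "periodic1 \<psi>"
      unfolding periodic1_def
    proof
      fix x
      have "\<phi> (x + 1 + t) = \<phi> (x + t)" for t
        by (rule periodic1_eqI[OF Suc.prems(2)]) simp
      then show "\<psi> (x + 1) = \<psi> x" by (simp add: \<psi>_def)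
    qed
    have "(\<integral>t. \<psi> t \<partial>lborel_unit) = (\<integral>t. \<integral>u. \<phi> (u + t) \<partial>lborel_unit \<partial>conv_pow K ?n)"
      unfolding \<psi>_def
    proof (intro P.Fubini_integral[symmetric])
      have [measurable]: "(\<lambda>x. x) \<in> measurable lborel_unit borel" by (intro measurable_unit) auto
      show "integrable (lborel_unit \<Otimes>\<^sub>M conv_pow K ?n) (case_prod (\<lambda>u t. \<phi> (u + t)))"
        using bd by (intro P.integrable_const_bound[of _ 1] AE_I2) auto
    qed
    also have "\<dots> = (\<integral>t. 0 \<partial>conv_pow K ?n)"
      using integral_unit_periodic_shift[OF Suc.prems(1,2) bd] Suc.prems(4)
      by (intro Bochner_Integration.integral_cong refl) (simp add: add.commute)
    finally have \<psi>0: "(\<integral>t. \<psi> t \<partial>lborel_unit) = 0" by simp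
    have "(\<integral>t. \<phi> (x + t) \<partial>conv_pow K (Suc j * m + i)) = (\<integral>t. \<phi> (x + t) \<partial>conv_pow K (m + ?n))"
      by (simp add: algebra_simps)
    also have "\<dots> = (\<integral>t. \<psi> (x + t) \<partial>conv_pow K m)"
      using bd unfolding \<psi>_def by (subst integral_conv_pow_add[where C=1]) (auto simp: add.assoc)
    also have "\<bar>\<dots>\<bar> \<le> (1 - c) * (1 - c) ^ j"
      using Suc.IH[OF Suc.prems] by (intro con \<psi>p \<psi>0) (auto simp: \<psi>_def)
    finally show ?case by simp
  qed
  \<comment> \<open>The rate per single step. The constant \<open>1 / \<theta> ^ m\<close> pays for
    rounding \<open>n\<close> down to a multiple of \<open>m\<close>.\<close>
  define \<theta> where "\<theta> = root m (1 - c)"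
  have \<theta>: "0 < \<theta>" "\<theta> < 1" "\<theta> ^ m = 1 - c" using mc by (auto simp: \<theta>_def)
  have "(1 - c) ^ (n div m) \<le> (1 / \<theta> ^ m) * \<theta> ^ n" for n
  proof -
    have "\<theta> ^ (n div m * m + m) \<le> \<theta> ^ n"
    proof (intro power_decreasing)
      have "n mod m < m" using mc by simp
      then show "n \<le> n div m * m + m" using div_mult_mod_eq[of n m] by linarith
    qed (use \<theta> in auto)
    moreover have "\<theta> ^ (n div m * m + m) = (1 - c) ^ (n div m) * \<theta> ^ m"
      using \<theta>(3) by (simp add: power_add mult.commute[of _ m] power_mult)
    ultimately show ?thesis using \<theta>(1) by (simp add: field_simps)
  qed
  note pow_bound = this
  have geo: "\<bar>\<integral>t. \<phi> (x + t) \<partial>conv_pow K n\<bar> \<le> (1 / \<theta> ^ m) * \<theta> ^ n"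
    if "\<phi> \<in> borel_measurable borel" "periodic1 \<phi>" "\<And>x. \<bar>\<phi> x :: real\<bar> \<le> 1"
      "(\<integral>t. \<phi> t \<partial>lborel_unit) = 0" for \<phi> x n
  proof -
    have "\<bar>\<integral>t. \<phi> (x + t) \<partial>conv_pow K (n div m * m + n mod m)\<bar> \<le> (1 - c) ^ (n div m)"
      by (rule iter) (fact that)+
    then show ?thesis using pow_bound[of n] by simp
  qed
  have "0 < 1 / \<theta> ^ m" using \<theta>(1) by simp
  with geo \<theta> show ?thesis by blast
qed

end

section \<open>Distance to the nearest integer\<close>

lemma dist_nearest_int_frac: "dist_nearest_int x = min (frac x) (1 - frac x)"
proof (cases "frac x \<ge> 1/2")
  case True
  then have "x \<notin> \<int>" by (metis frac_eq_0_iff not_one_le_zero half_gt_zero_iff less_numeral_extra(1) not_less)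
  then have "of_int (ceiling x) = (of_int (floor x) + 1 :: real)"
    by (metis ceiling_altdef Ints_of_int of_int_1 of_int_add)
  then show ?thesis using True frac_lt_1[of x]
    by (simp add: dist_nearest_int_def round_altdef frac_def min_def)
next
  case False
  then show ?thesis using frac_ge_0[of x]
    by (simp add: dist_nearest_int_def round_altdef min_def) (simp add: frac_def)
qed

lemma dist_nearest_int_add_int:
  assumes "x - y \<in> \<int>" shows "dist_nearest_int x = dist_nearest_int y"
proof -
  obtain k :: int where "x = y + of_int k" using assms by (metis Ints_cases add.commute diff_add_cancel)
  then have "frac x = frac y" by (simp add: frac_def)
  then show ?thesis by (simp add: dist_nearest_int_frac)
qed

lemma dist_nearest_int_minus: "dist_nearest_int (- x) = dist_nearest_int x"
proof (cases "x \<in> \<int>")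
  case True
  then show ?thesis by (simp add: dist_nearest_int_frac frac_neg frac_eq_0_iff[THEN iffD2, OF True])
qed (auto simp: dist_nearest_int_frac frac_neg min_def)

lemma dist_nearest_int_eq_0_iff: "dist_nearest_int x = 0 \<longleftrightarrow> x \<in> \<int>"
proof (cases "x \<in> \<int>")
  case True
  then show ?thesis by (simp add: dist_nearest_int_frac frac_eq_0_iff[THEN iffD2, OF True])
next
  case False
  then have "frac x \<noteq> 0" using frac_eq_0_iff[of x] by simp
  then show ?thesis using False frac_lt_1[of x] by (auto simp: dist_nearest_int_frac min_def)
qed

lemma dist_nearest_int_nonneg: "0 \<le> dist_nearest_int x"
  by (simp add: dist_nearest_int_def)

lemma measurable_dist_nearest_int[measurable]: "dist_nearest_int \<in> borel_measurable borel"
  unfolding dist_nearest_int_frac frac_def by measurable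

definition near_int :: "real \<Rightarrow> real \<Rightarrow> real" where
  "near_int \<delta> x = indicator {x. dist_nearest_int x \<le> \<delta>} x"

lemma near_int_iff: "near_int \<delta> x = (if dist_nearest_int x \<le> \<delta> then 1 else 0)"
  by (auto simp: near_int_def)

lemma near_int_bounds[simp]: "0 \<le> near_int \<delta> x" "near_int \<delta> x \<le> 1"
  by (auto simp: near_int_def indicator_def)

lemma measurable_near_int[measurable]: "near_int \<delta> \<in> borel_measurable borel"
  unfolding near_int_def by measurable

lemma periodic1_near_int: "periodic1 (near_int \<delta>)"
  unfolding periodic1_def near_int_iff
proof
  fix x :: real
  show "(if dist_nearest_int (x + 1) \<le> \<delta> then 1 else 0 :: real) = (if dist_nearest_int x \<le> \<delta> then 1 else 0)"
    using dist_nearest_int_add_int[of "x + 1" x] by simp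
qed

text \<open>For \<delta> < 1/2 the two arcs at the ends of the unit interval are disjoint and have
  length \<delta> each.\<close>

lemma emeasure_near_int:
  assumes "0 \<le> \<delta>" "\<delta> < 1/2"
  shows "emeasure lborel ({t. dist_nearest_int t \<le> \<delta>} \<inter> {0..<1}) = ennreal (2 * \<delta>)"
proof -
  have "{t. dist_nearest_int t \<le> \<delta>} \<inter> {0..<1} = {0..\<delta>} \<union> {1-\<delta>..<1}"
  proof -
    have "dist_nearest_int t = min t (1 - t)" if "t \<in> {0..<1}" for t
      using that frac_eq[of t] by (auto simp: dist_nearest_int_frac)
    then show ?thesis using assms by (auto simp: min_def split: if_splits)
  qed
  moreover have "emeasure lborel ({0..\<delta>} \<union> {1-\<delta>..<1}) = emeasure lborel {0..\<delta>} + emeasure lborel {1-\<delta>..<1}"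
    using assms by (intro plus_emeasure[symmetric]) auto
  moreover have "\<dots> = ennreal (2 * \<delta>)"
    using assms by (simp flip: ennreal_plus)
  ultimately show ?thesis by simp
qed

lemma integral_near_int:
  assumes "0 \<le> \<delta>" "\<delta> < 1/2"
  shows "(\<integral>t. near_int \<delta> t \<partial>lborel_unit) = 2 * \<delta>"
proof -
  have "(\<integral>t. near_int \<delta> t \<partial>lborel_unit) = measure lborel_unit ({t. dist_nearest_int t \<le> \<delta>} \<inter> {0..<1})"
    unfolding near_int_def by (simp add: space_restrict_space Int_commute)
  also have "\<dots> = measure lborel ({t. dist_nearest_int t \<le> \<delta>} \<inter> {0..<1})"
    by (intro measure_restrict_space) auto
  also have "\<dots> = 2 * \<delta>" using emeasure_near_int[OF assms] assms by (simp add: measure_def)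
  finally show ?thesis .
qed

section \<open>Sums of independent steps\<close>

locale step_walk = ac_law K F + M: prob_space M
  for K F and M :: "'a measure" +
  fixes Y :: "nat \<Rightarrow> 'a \<Rightarrow> real"
  assumes Y_indep: "M.indep_vars (\<lambda>_. borel) Y {1..}"
    and Y_law: "\<And>n. 1 \<le> n \<Longrightarrow> distr M borel (Y n) = K"
begin

text \<open>Indexed by sets and not only by intervals, since a block will be removed from an
  interval of steps.\<close>

definition incr :: "nat set \<Rightarrow> 'a \<Rightarrow> real" where
  "incr J \<omega> = (\<Sum>m\<in>J. Y m \<omega>)"

lemma measurable_Y: "1 \<le> n \<Longrightarrow> Y n \<in> borel_measurable M"
  using Y_indep by (auto simp: M.indep_vars_def)

lemma measurable_incr: "J \<subseteq> {1..} \<Longrightarrow> incr J \<in> borel_measurable M"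
  unfolding incr_def[abs_def] using measurable_Y by (intro borel_measurable_sum) auto

lemma distr_incr:
  assumes "finite J" "J \<subseteq> {1..}"
  shows "distr M borel (incr J) = conv_pow K (card J)"
  using assms
proof (induction J rule: finite_induct)
  case empty
  have "distr M borel (\<lambda>_. 0 :: real) = return borel 0" by (rule M.distr_const) auto
  then show ?case by (simp add: incr_def[abs_def])
next
  case (insert m J)
  have ind: "M.indep_var borel (Y m) borel (\<lambda>\<omega>. \<Sum>i\<in>J. Y i \<omega>)"
    using insert by (intro M.indep_vars_sum M.indep_vars_subset[OF Y_indep]) auto
  have "distr M borel (incr (insert m J)) = distr M borel (\<lambda>\<omega>. Y m \<omega> + incr J \<omega>)"
    using insert by (simp add: incr_def[abs_def])
  also have "\<dots> = convolution (distr M borel (Y m)) (distr M borel (incr J))"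
    using ind insert measurable_Y[of m] measurable_incr[of J]
    by (intro M.sum_indep_random_variable) (auto simp: incr_def[abs_def])
  finally show ?case using insert Y_law[of m] by simp
qed

lemma expectation_incr:
  fixes f :: "real \<Rightarrow> real"
  assumes "finite J" "J \<subseteq> {1..}" "f \<in> borel_measurable borel"
  shows "M.expectation (\<lambda>\<omega>. f (incr J \<omega>)) = (\<integral>t. f t \<partial>conv_pow K (card J))"
  using assms measurable_incr by (simp add: distr_incr[symmetric] integral_distr)

text \<open>A block \<open>J\<close> of increments that enters only the first factor can be averaged out first.\<close>

lemma expectation_private_block:
  assumes fin: "finite J" "finite A" "finite B" "J \<union> A \<union> B \<subseteq> {1..}" "J \<inter> A = {}" "J \<inter> B = {}"
    and [measurable]: "\<phi> \<in> borel_measurable borel" "\<psi> \<in> borel_measurable borel"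
    and bd: "\<And>x. \<bar>\<phi> x :: real\<bar> \<le> 1" "\<And>x. \<bar>\<psi> x :: real\<bar> \<le> 1"
    and eps: "\<And>x. \<bar>\<integral>t. \<phi> (x + t) \<partial>conv_pow K (card J)\<bar> \<le> \<epsilon>"
  shows "\<bar>M.expectation (\<lambda>\<omega>. \<phi> (incr (J \<union> A) \<omega>) * \<psi> (incr B \<omega>))\<bar> \<le> \<epsilon>"
proof -
  \<comment> \<open>\<open>A\<close> and \<open>B\<close> may overlap, so the sums over them are in
    general dependent. What is independent of the steps in \<open>J\<close> is the whole vector of
    steps in \<open>A \<union> B\<close>, which is why joint laws on product spaces appear.\<close>
  define p where "p I \<omega> = restrict (\<lambda>i. Y i \<omega>) I" for I \<omega>
  define B1 where "B1 = Pi\<^sub>M J (\<lambda>_. borel :: real measure)"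
  define B2 where "B2 = Pi\<^sub>M (A \<union> B) (\<lambda>_. borel :: real measure)"
  have ind: "M.indep_var B1 (p J) B2 (p (A \<union> B))"
    unfolding p_def B1_def B2_def using fin by (intro M.indep_var_restrict[OF Y_indep]) auto
  have [measurable]: "p J \<in> measurable M B1" "p (A \<union> B) \<in> measurable M B2"
    using ind by (auto simp: M.indep_var_distribution_eq)
  have [measurable]: "incr J \<in> borel_measurable M" "incr A \<in> borel_measurable M" "incr B \<in> borel_measurable M"
    using fin by (auto intro!: measurable_incr)
  define Q where "Q = distr M B1 (p J)"
  define R where "R = distr M B2 (p (A \<union> B))"
  have [measurable_cong]: "sets Q = sets B1" "sets R = sets B2" by (simp_all add: Q_def R_def)
  interpret Q: prob_space Q unfolding Q_def by (intro M.prob_space_distr) auto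
  interpret R: prob_space R unfolding R_def by (intro M.prob_space_distr) auto
  interpret P: pair_prob_space Q R ..
  have law: "Q \<Otimes>\<^sub>M R = distr M (B1 \<Otimes>\<^sub>M B2) (\<lambda>\<omega>. (p J \<omega>, p (A \<union> B) \<omega>))"
    using ind unfolding M.indep_var_distribution_eq Q_def R_def by simp
  have split: "incr (J \<union> A) \<omega> = incr A \<omega> + incr J \<omega>" for \<omega>
    using fin by (simp add: incr_def sum.union_disjoint)
  have sJ[measurable]: "(\<lambda>f. \<Sum>i\<in>J. f i) \<in> borel_measurable B1"
    unfolding B1_def by (intro borel_measurable_sum) auto
  have [measurable]: "(\<lambda>f. \<Sum>i\<in>A. f i) \<in> borel_measurable B2" "(\<lambda>f. \<Sum>i\<in>B. f i) \<in> borel_measurable B2"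
    unfolding B2_def by (intro borel_measurable_sum measurable_component_singleton; auto)+
  define G where "G = (\<lambda>(f, g). \<phi> ((\<Sum>i\<in>A. g i) + (\<Sum>i\<in>J. f i)) * \<psi> (\<Sum>i\<in>B. g i))"
  have Gm[measurable]: "G \<in> borel_measurable (B1 \<Otimes>\<^sub>M B2)"
    unfolding G_def by measurable
  have Gp: "G (p J \<omega>, p (A \<union> B) \<omega>) = \<phi> (incr A \<omega> + incr J \<omega>) * \<psi> (incr B \<omega>)" for \<omega>
    by (simp add: G_def p_def incr_def)
  \<comment> \<open>Averaging over the block alone leaves the steps in \<open>A\<close> as a fixed
    shift \<open>u\<close> of the argument; this is why \<open>eps\<close> asks for a bound uniform
    in the shift.\<close>
  have inner: "(\<integral>f. \<phi> (u + (\<Sum>i\<in>J. f i)) \<partial>Q) = (\<integral>t. \<phi> (u + t) \<partial>conv_pow K (card J))" for u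
  proof -
    have "(\<integral>f. \<phi> (u + (\<Sum>i\<in>J. f i)) \<partial>Q) = M.expectation (\<lambda>\<omega>. \<phi> (u + incr J \<omega>))"
      unfolding Q_def by (subst integral_distr) (auto simp: p_def incr_def)
    also have "\<dots> = (\<integral>t. \<phi> (u + t) \<partial>conv_pow K (card J))"
      using fin by (intro expectation_incr[where f="\<lambda>t. \<phi> (u + t)"]) auto
    finally show ?thesis .
  qed
  have Gb: "\<bar>G z\<bar> \<le> 1" for z
    using bd by (auto simp: G_def abs_mult split: prod.split intro: mult_le_one)
  have "M.expectation (\<lambda>\<omega>. \<phi> (incr (J \<union> A) \<omega>) * \<psi> (incr B \<omega>)) = (\<integral>z. G z \<partial>(Q \<Otimes>\<^sub>M R))"
    unfolding law split by (subst integral_distr) (auto simp: Gp)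
  also have "\<dots> = (\<integral>w. (\<integral>t. G (t, w) \<partial>Q) \<partial>R)"
  proof -
    have "(\<integral>w. (\<integral>t. G (t, w) \<partial>Q) \<partial>R) = (\<integral>z. case_prod (\<lambda>t w. G (t, w)) z \<partial>(Q \<Otimes>\<^sub>M R))"
      using Gb by (intro P.integral_snd P.integrable_const_bound[of _ 1]) auto
    then show ?thesis by simp
  qed
  also have "\<bar>\<dots>\<bar> \<le> (\<integral>w. \<bar>\<integral>t. G (t, w) \<partial>Q\<bar> \<partial>R)"
    by (rule integral_abs_bound)
  also have "\<dots> \<le> \<epsilon>"
  proof (intro R.integral_le_const AE_I2)
    show b: "\<bar>\<integral>t. G (t, w) \<partial>Q\<bar> \<le> \<epsilon>" for w
    proof -
      have "\<bar>\<integral>t. G (t, w) \<partial>Q\<bar> = \<bar>\<integral>t. \<phi> ((\<Sum>i\<in>A. w i) + t) \<partial>conv_pow K (card J)\<bar> * \<bar>\<psi> (\<Sum>i\<in>B. w i)\<bar>"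
        by (simp add: G_def abs_mult inner)
      also have "\<dots> \<le> \<epsilon> * 1" using eps bd order_trans[OF abs_ge_zero eps] by (intro mult_mono) auto
      finally show ?thesis by simp
    qed
    show "integrable R (\<lambda>w. \<bar>\<integral>t. G (t, w) \<partial>Q\<bar>)"
      using b by (intro R.integrable_const_bound[of _ \<epsilon>] AE_I2) auto
  qed
  finally show ?thesis .
qed

end

section \<open>Pair correlations as sums over index pairs\<close>

definition index_pairs :: "nat \<Rightarrow> (nat \<times> nat) set" where
  "index_pairs N = {(i, j). 1 \<le> i \<and> i < j \<and> j \<le> N}"

lemma index_pairs_Sigma: "index_pairs N = Sigma {1..N} (\<lambda>i. {i<..N})"
  by (auto simp: index_pairs_def)

lemma finite_index_pairs[simp]: "finite (index_pairs N)"
  unfolding index_pairs_Sigma by (intro finite_SigmaI) auto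

lemma index_pairs_Sigma': "index_pairs N = (\<lambda>(j, i). (i, j)) ` Sigma {1..N} (\<lambda>j. {1..<j})"
  by (force simp: index_pairs_def)

lemma sum_index_pairs: "(\<Sum>p\<in>index_pairs N. f p) = (\<Sum>j=1..N. \<Sum>i=1..<j. f (i, j))"
  unfolding index_pairs_Sigma'
  by (subst sum.reindex) (auto simp: inj_on_def sum.Sigma intro!: sum.cong)

lemma card_index_pairs: "real (card (index_pairs N)) = real N * (real N - 1) / 2"
proof -
  have "real (card (index_pairs N)) = (\<Sum>p\<in>index_pairs N. 1)" by simp
  also have "\<dots> = (\<Sum>j=1..N. real (j - 1))" unfolding sum_index_pairs by simp
  also have "\<dots> = real N * (real N - 1) / 2"
    by (induction N) (auto simp: field_simps)
  finally show ?thesis .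
qed

text \<open>The distance is symmetric, so every pair with i < j is counted twice.\<close>

lemma pair_corr_index_pairs:
  "pair_corr x s N = 2 / real N * (\<Sum>(i, j)\<in>index_pairs N. near_int (s / real N) (x i - x j))"
proof -
  define Q where "Q = {(i, j). 1 \<le> i \<and> i < j \<and> j \<le> N \<and> dist_nearest_int (x i - x j) \<le> s / real N}"
  have fQ: "finite Q" by (rule finite_subset[OF _ finite_index_pairs[of N]]) (auto simp: Q_def index_pairs_def)
  have sym: "dist_nearest_int (x j - x i) = dist_nearest_int (x i - x j)" for i j
    using dist_nearest_int_minus[of "x i - x j"] by simp
  have "{(i, j). i \<in> {1..N} \<and> j \<in> {1..N} \<and> i \<noteq> j \<and> dist_nearest_int (x i - x j) \<le> s / real N} = Q \<union> prod.swap ` Q"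
  proof (intro set_eqI iffI)
    fix p assume p: "p \<in> {(i, j). i \<in> {1..N} \<and> j \<in> {1..N} \<and> i \<noteq> j \<and> dist_nearest_int (x i - x j) \<le> s / real N}"
    obtain i j where ij: "p = (i, j)" by force
    show "p \<in> Q \<union> prod.swap ` Q"
    proof (cases "i < j")
      case True
      then show ?thesis using p ij by (auto simp: Q_def)
    next
      case False
      then have "(j, i) \<in> Q" using p ij sym[of j i] by (auto simp: Q_def)
      then show ?thesis using ij by force
    qed
  qed (auto simp: Q_def sym)
  moreover have "Q \<inter> prod.swap ` Q = {}" by (auto simp: Q_def)
  moreover have "card (prod.swap ` Q) = card Q" by (intro card_image) (auto simp: inj_on_def)
  ultimately have "card {(i, j). i \<in> {1..N} \<and> j \<in> {1..N} \<and> i \<noteq> j \<and> dist_nearest_int (x i - x j) \<le> s / real N} = 2 * card Q"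
    using fQ by (simp add: card_Un_disjoint)
  moreover have "real (card Q) = (\<Sum>(i, j)\<in>index_pairs N. near_int (s / real N) (x i - x j))"
  proof -
    have "(\<Sum>(i, j)\<in>index_pairs N. near_int (s / real N) (x i - x j)) = (\<Sum>p\<in>Q. 1)"
      by (rule sum.mono_neutral_cong_right[OF finite_index_pairs]) (auto simp: Q_def index_pairs_def near_int_iff split: if_splits)
    then show ?thesis by simp
  qed
  ultimately show ?thesis by (simp add: pair_corr_def)
qed

section \<open>Monotonicity of the pair count and passage from a subsequence to all N\<close>

lemma pairs_monotone:
  assumes "N \<le> N'" "\<delta> \<le> \<delta>'"
  shows "(\<Sum>(i, j)\<in>index_pairs N. near_int \<delta> (x i - x j)) \<le> (\<Sum>(i, j)\<in>index_pairs N'. near_int \<delta>' (x i - x j))"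
proof -
  have "(\<Sum>(i, j)\<in>index_pairs N. near_int \<delta> (x i - x j)) \<le> (\<Sum>(i, j)\<in>index_pairs N. near_int \<delta>' (x i - x j))"
    using assms by (intro sum_mono) (auto simp: near_int_iff)
  also have "\<dots> \<le> (\<Sum>(i, j)\<in>index_pairs N'. near_int \<delta>' (x i - x j))"
    using assms by (intro sum_mono2 finite_index_pairs) (auto simp: index_pairs_def)
  finally show ?thesis .
qed

text \<open>The count grows with the number of points and with the threshold; only the normalisation
  has to be corrected, by the factor \<open>N' / N\<close>.\<close>

lemma pair_corr_compare:
  assumes "0 < N" "N \<le> N'" "s / real N \<le> s' / real N'"
  shows "pair_corr x s N \<le> real N' / real N * pair_corr x s' N'"
  using pairs_monotone[OF assms(2,3), of x] assms(1,2)
  by (simp add: pair_corr_index_pairs field_simps)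

lemma pair_corr_nonneg: "0 \<le> pair_corr x s N"
  by (simp add: pair_corr_def)

lemma power_floor_root:
  fixes A :: nat assumes "1 \<le> A"
  shows "\<exists>f :: nat \<Rightarrow> nat. filterlim f at_top sequentially \<and> (\<forall>N. f N ^ A \<le> N \<and> N < (f N + 1) ^ A)"
proof -
  have "\<exists>m::nat. m ^ A \<le> N \<and> N < (m + 1) ^ A" for N :: nat
  proof -
    have bd: "m \<le> N" if "m ^ A \<le> N" for m
      using that self_le_power[of m A] assms by (cases "m = 0") (auto intro: order_trans)
    define m where "m = (GREATEST m. m ^ A \<le> N)"
    have m: "m ^ A \<le> N" unfolding m_def
      using bd assms by (intro GreatestI_nat[of "\<lambda>m. m ^ A \<le> N" 0 N]) (auto simp: power_0_left)
    have "\<not> (m + 1) ^ A \<le> N"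
    proof
      assume "(m + 1) ^ A \<le> N"
      then have "m + 1 \<le> m" unfolding m_def
        by (intro Greatest_le_nat[of "\<lambda>m. m ^ A \<le> N" _ N]) (use bd in auto)
      then show False by simp
    qed
    then show ?thesis using m by (intro exI[of _ m]) auto
  qed
  then have "\<forall>N::nat. \<exists>m::nat. m ^ A \<le> N \<and> N < (m + 1) ^ A" by blast
  from choice[OF this] obtain f :: "nat \<Rightarrow> nat" where f: "\<And>N. f N ^ A \<le> N \<and> N < (f N + 1) ^ A" by blast
  have "filterlim f at_top sequentially"
  proof (subst filterlim_at_top, intro allI)
    fix Z :: nat
    have "Z \<le> f N" if "Z ^ A \<le> N" for N
    proof (rule ccontr)
      assume "\<not> Z \<le> f N"
      then have "(f N + 1) ^ A \<le> Z ^ A" by (intro power_mono) auto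
      then show False using f[of N] that by linarith
    qed
    then show "eventually (\<lambda>N. Z \<le> f N) sequentially"
      by (rule eventually_sequentiallyI)
  qed
  then show ?thesis using f by blast
qed

lemma ratio_power_tendsto_1: "(\<lambda>m::nat. (real (m + 1) / real m) ^ A) \<longlonglongrightarrow> 1"
proof -
  have "(\<lambda>m::nat. real (m + 1) / real m) \<longlonglongrightarrow> 1"
    using LIMSEQ_Suc_n_over_n[where 'a=real] by simp
  from tendsto_power[OF this, of A] show ?thesis by simp
qed

text \<open>Consecutive elements of \<open>(m ^ A)\<close> have quotient tending to 1, so monotonicity of the
  pair count fills the gaps.\<close>

lemma poissonian_if_poissonian_along_powers:
  fixes A :: nat
  assumes A: "1 \<le> A"
    and lim: "\<And>q. q \<in> \<rat> \<Longrightarrow> 0 < q \<Longrightarrow> (\<lambda>m. pair_corr x q (m ^ A)) \<longlonglongrightarrow> 2 * q"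
  shows "poissonian_pair_correlations x"
  unfolding poissonian_pair_correlations_def
proof (intro allI impI)
  fix s :: real assume s: "0 \<le> s"
  obtain f where flim: "filterlim f at_top sequentially"
    and f: "\<And>N. f N ^ A \<le> N" "\<And>N. N < (f N + 1) ^ A" using power_floor_root[OF A] by blast
  \<comment> \<open>The quotient of consecutive sample sizes \<open>(m + 1) ^ A\<close> and
    \<open>m ^ A\<close>.\<close>
  define \<rho> where "\<rho> = (\<lambda>m::nat. (real (m + 1) / real m) ^ A)"
  have \<rho>: "\<rho> \<longlonglongrightarrow> 1" unfolding \<rho>_def by (rule ratio_power_tendsto_1)
  have ev1: "eventually (\<lambda>N. 1 \<le> f N) sequentially"
    using flim by (simp add: filterlim_at_top)
  have upper: "eventually (\<lambda>N. pair_corr x s N < b) sequentially" if b: "2 * s < b" for b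
  proof -
    \<comment> \<open>The gap between \<open>s\<close> and \<open>q\<close> absorbs the quotient:
      for m^A \<le> N < (m+1)^A one has s / N \<le> s * \<rho> m / (m+1)^A \<le> q / (m+1)^A. It is
      rational because the limit along powers is available for rational parameters.\<close>
    obtain q where q: "q \<in> \<rat>" "s < q" "q < b / 2" using Rats_dense_in_real[of s "b/2"] b by auto
    have "(\<lambda>m. s * \<rho> m) \<longlonglongrightarrow> s * 1" by (intro tendsto_intros \<rho>)
    then have e1: "eventually (\<lambda>m. s * \<rho> m < q) sequentially" using q by (intro order_tendstoD) auto
    have lq: "(\<lambda>m. \<rho> m * pair_corr x q (Suc m ^ A)) \<longlonglongrightarrow> 1 * (2 * q)"
      using q s by (intro tendsto_mult \<rho> LIMSEQ_Suc[of "\<lambda>m. pair_corr x q (m ^ A)"] lim) auto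
    have e2: "eventually (\<lambda>m. \<rho> m * pair_corr x q (Suc m ^ A) < b) sequentially"
      using order_tendstoD(2)[OF lq, of b] q by simp
    have "eventually (\<lambda>N. s * \<rho> (f N) < q \<and> \<rho> (f N) * pair_corr x q (Suc (f N) ^ A) < b) sequentially"
      using filterlim_iff[THEN iffD1, OF flim] eventually_conj[OF e1 e2] by blast
    with ev1 show ?thesis
    proof eventually_elim
      case (elim N)
      let ?m = "f N"
      have N: "0 < N" using f(1)[of N] elim(1) by (metis gr_zeroI le_zero_eq not_one_le_zero power_eq_0_iff)
      have mN: "real ?m ^ A \<le> real N" using f(1)[of N] by (metis of_nat_le_iff of_nat_power)
      have mpos: "0 < real ?m ^ A" using elim by simp
      have \<rho>eq: "\<rho> ?m = real (Suc ?m ^ A) / real ?m ^ A" by (simp add: \<rho>_def power_divide)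
      have "s / real N \<le> s / real ?m ^ A" using s mN mpos N by (intro divide_left_mono mult_pos_pos) auto
      also have "\<dots> = s * \<rho> ?m / real (Suc ?m ^ A)" by (simp add: \<rho>eq)
      also have "\<dots> \<le> q / real (Suc ?m ^ A)" using elim by (intro divide_right_mono) auto
      finally have "pair_corr x s N \<le> real (Suc ?m ^ A) / real N * pair_corr x q (Suc ?m ^ A)"
        using N f(2)[of N] by (intro pair_corr_compare) auto
      also have "\<dots> \<le> \<rho> ?m * pair_corr x q (Suc ?m ^ A)"
        unfolding \<rho>eq using mN mpos N by (intro mult_right_mono divide_left_mono pair_corr_nonneg) auto
      finally show ?case using elim by simp
    qed
  qed
  have lower: "eventually (\<lambda>N. b < pair_corr x s N) sequentially" if b: "b < 2 * s" for b
  \<comment> \<open>In this case \<open>b\<close> is negative and the pair count is not. Otherwise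
    \<open>b / 2\<close> is nonnegative, so that the rational chosen between \<open>b / 2\<close>
    and \<open>s\<close> is positive, as \<open>lim\<close> demands.\<close>
  proof (cases "s = 0 \<or> b < 0")
    case True
    then have "b < 0" using b s by auto
    then show ?thesis using pair_corr_nonneg less_le_trans by (intro always_eventually allI) blast
  next
    case False
    then have sb: "0 < s" "0 \<le> b" using s by auto
    obtain q where q: "q \<in> \<rat>" "b / 2 < q" "q < s" using Rats_dense_in_real[of "b/2" s] b by auto
    have qpos: "0 < q" using q sb by auto
    have "(\<lambda>m. q * \<rho> m) \<longlonglongrightarrow> q * 1" by (intro tendsto_intros \<rho>)
    then have e1: "eventually (\<lambda>m. q * \<rho> m < s) sequentially" using q by (intro order_tendstoD) auto
    have lq: "(\<lambda>m. pair_corr x q (m ^ A) / \<rho> m) \<longlonglongrightarrow> (2 * q) / 1"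
      using q qpos by (intro tendsto_divide \<rho> lim) auto
    have e2: "eventually (\<lambda>m. b < pair_corr x q (m ^ A) / \<rho> m) sequentially"
      using order_tendstoD(1)[OF lq, of b] q by simp
    have "eventually (\<lambda>N. q * \<rho> (f N) < s \<and> b < pair_corr x q (f N ^ A) / \<rho> (f N)) sequentially"
      using filterlim_iff[THEN iffD1, OF flim] eventually_conj[OF e1 e2] by blast
    with ev1 show ?thesis
    proof eventually_elim
      case (elim N)
      let ?m = "f N"
      have m: "0 < ?m ^ A" using elim by simp
      have N: "0 < N" using f(1)[of N] m by linarith
      have mN: "real N \<le> real (Suc ?m ^ A)" using f(2)[of N] by (simp only: of_nat_le_iff) simp
      have mpos: "0 < real ?m ^ A" using elim by simp
      have \<rho>eq: "\<rho> ?m = real (Suc ?m ^ A) / real ?m ^ A" by (simp add: \<rho>_def power_divide)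
      have spos: "0 < real (Suc ?m ^ A)" by simp
      have "q / real (?m ^ A) = q * \<rho> ?m / real (Suc ?m ^ A)" using spos by (simp add: \<rho>eq)
      also have "\<dots> \<le> s / real (Suc ?m ^ A)" using elim by (intro divide_right_mono) auto
      also have "\<dots> \<le> s / real N" using s mN N by (intro divide_left_mono) auto
      finally have *: "pair_corr x q (?m ^ A) \<le> real N / real (?m ^ A) * pair_corr x s N"
        using m f(1)[of N] by (intro pair_corr_compare)
      also have "\<dots> \<le> \<rho> ?m * pair_corr x s N"
        unfolding \<rho>eq using mN mpos by (intro mult_right_mono pair_corr_nonneg) (auto intro: divide_right_mono)
      finally have "pair_corr x q (?m ^ A) / \<rho> ?m \<le> pair_corr x s N"
        using mpos spos by (simp add: \<rho>eq field_simps)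
      then show ?case using elim by simp
    qed
  qed
  show "(\<lambda>N. pair_corr x s N) \<longlonglongrightarrow> 2 * s"
    using upper lower by (intro order_tendstoI) auto
qed

text \<open>The sum of all \<open>W m\<close> has finite expectation, hence is finite almost surely,
  and the terms of a convergent series tend to 0.\<close>

lemma (in prob_space) AE_tendsto_0_if_summable_expectation:
  fixes W :: "nat \<Rightarrow> 'a \<Rightarrow> real"
  assumes int: "\<And>m. integrable M (W m)" and nonneg: "\<And>m \<omega>. 0 \<le> W m \<omega>"
    and summ: "summable (\<lambda>m. expectation (W m))"
  shows "AE \<omega> in M. (\<lambda>m. W m \<omega>) \<longlonglongrightarrow> 0"
proof -
  have [measurable]: "W m \<in> borel_measurable M" for m using int by auto
  have "(\<integral>\<^sup>+\<omega>. (\<Sum>m. ennreal (W m \<omega>)) \<partial>M) = (\<Sum>m. \<integral>\<^sup>+\<omega>. ennreal (W m \<omega>) \<partial>M)"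
    by (rule nn_integral_suminf) auto
  also have "\<dots> = (\<Sum>m. ennreal (expectation (W m)))"
    using int nonneg by (intro suminf_cong nn_integral_eq_integral) auto
  also have "\<dots> = ennreal (\<Sum>m. expectation (W m))"
    using summ nonneg by (intro suminf_ennreal2) auto
  finally have "(\<integral>\<^sup>+\<omega>. (\<Sum>m. ennreal (W m \<omega>)) \<partial>M) \<noteq> \<infinity>" by simp
  then have "AE \<omega> in M. (\<Sum>m. ennreal (W m \<omega>)) \<noteq> \<infinity>"
    by (intro nn_integral_noteq_infinite) auto
  then show ?thesis
  proof eventually_elim
    case (elim \<omega>)
    then have "summable (\<lambda>m. W m \<omega>)" using nonneg by (intro summable_suminf_not_top) auto
    then show ?case by (rule summable_LIMSEQ_zero)
  qed
qed

section \<open>Convergence of the expected pair count\<close>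

context step_walk
begin

text \<open>The steps \<open>Y i\<close>, ..., \<open>Y (j - 1)\<close> lead from \<open>X i\<close>
  to \<open>X j\<close>, hence the half-open range. The starting point of the walk has
  cancelled.\<close>

definition near_ind :: "real \<Rightarrow> nat \<times> nat \<Rightarrow> 'a \<Rightarrow> real" where
  "near_ind \<delta> p \<omega> = near_int \<delta> (incr {fst p..<snd p} \<omega>)"

lemma near_ind_bounds[simp]: "0 \<le> near_ind \<delta> p \<omega>" "near_ind \<delta> p \<omega> \<le> 1"
  by (auto simp: near_ind_def)

lemma measurable_near_ind: "1 \<le> fst p \<Longrightarrow> near_ind \<delta> p \<in> borel_measurable M"
  unfolding near_ind_def[abs_def]
  by (intro measurable_compose[OF measurable_incr measurable_near_int]) auto

lemma integrable_near_ind: "1 \<le> fst p \<Longrightarrow> integrable M (near_ind \<delta> p)"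
  using measurable_near_ind by (intro M.integrable_const_bound[of _ 1]) auto

lemma expectation_near_ind:
  assumes "1 \<le> fst p"
  shows "M.expectation (near_ind \<delta> p) = (\<integral>t. near_int \<delta> t \<partial>conv_pow K (snd p - fst p))"
proof -
  have "{fst p..<snd p} \<subseteq> {1..}" using assms by auto
  then show ?thesis
    using expectation_incr[of "{fst p..<snd p}" "near_int \<delta>"] by (simp add: near_ind_def[abs_def])
qed

text \<open>For \<delta> < 1/2 the number \<open>2 * \<delta>\<close> is the mean under the uniform
  law. The constants are uniform in \<delta>, which later depends on \<open>N\<close>, and in the
  shift \<open>x\<close>, which later carries the other steps.\<close>

definition ergodic_rate :: "real \<Rightarrow> real \<Rightarrow> bool" where
  "ergodic_rate C \<theta> \<longleftrightarrow> 0 < C \<and> 0 < \<theta> \<and> \<theta> < 1 \<and> (\<forall>\<delta> n x. 0 \<le> \<delta> \<longrightarrow> \<delta> < 1/2 \<longrightarrow>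
     \<bar>\<integral>t. near_int \<delta> (x + t) - 2 * \<delta> \<partial>conv_pow K n\<bar> \<le> C * \<theta> ^ n)"

lemma ergodic_rate_exists: "\<exists>C \<theta>. ergodic_rate C \<theta>"
proof -
  obtain C \<theta> where C: "0 < C" "0 < \<theta>" "\<theta> < 1" and
    erg: "\<And>\<phi> n x. \<phi> \<in> borel_measurable borel \<Longrightarrow> periodic1 \<phi> \<Longrightarrow> (\<And>x. \<bar>\<phi> x :: real\<bar> \<le> 1) \<Longrightarrow>
     (\<integral>t. \<phi> t \<partial>lborel_unit) = 0 \<Longrightarrow> \<bar>\<integral>t. \<phi> (x + t) \<partial>conv_pow K n\<bar> \<le> C * \<theta> ^ n"
    using geometric_ergodicity by blast
  interpret U: prob_space lborel_unit by (rule prob_space_unit)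
  have "\<bar>\<integral>t. near_int \<delta> (x + t) - 2 * \<delta> \<partial>conv_pow K n\<bar> \<le> C * \<theta> ^ n" if \<delta>: "0 \<le> \<delta>" "\<delta> < 1/2" for \<delta> n x
  proof (rule erg[of "\<lambda>t. near_int \<delta> t - 2 * \<delta>"])
    show "periodic1 (\<lambda>t. near_int \<delta> t - 2 * \<delta>)" using periodic1_near_int[of \<delta>] by (simp add: periodic1_def)
    show "\<bar>near_int \<delta> t - 2 * \<delta>\<bar> \<le> 1" for t
      using near_int_bounds[of \<delta> t] \<delta> by linarith
    have "integrable lborel_unit (near_int \<delta>)"
      by (intro U.integrable_const_bound[of _ 1] AE_I2 measurable_unit) auto
    then show "(\<integral>t. near_int \<delta> t - 2 * \<delta> \<partial>lborel_unit) = 0"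
      using integral_near_int[OF \<delta>] U.prob_space by simp
  qed simp
  then show ?thesis using C unfolding ergodic_rate_def by blast
qed

lemma integral_near_int_minus_const:
  "(\<integral>t. near_int \<delta> (x + t) - c \<partial>conv_pow K n) = (\<integral>t. near_int \<delta> (x + t) \<partial>conv_pow K n) - c"
proof -
  interpret C: prob_space "conv_pow K n" by (rule prob_space_conv_pow)
  have "integrable (conv_pow K n) (\<lambda>t. near_int \<delta> (x + t))"
    by (intro C.integrable_const_bound[of _ 1]) auto
  then show ?thesis using C.prob_space by simp
qed

text \<open>Given the sum \<open>x\<close> of the first \<open>n\<close> steps, the last step would
  have to hit the countable set of all integers minus \<open>x\<close>, which is null for a law with
  a density.\<close>

lemma conv_pow_Ints_null: "AE t in conv_pow K (Suc n). t \<notin> \<int>"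
proof -
  have [measurable]: "(\<int> :: real set) \<in> sets borel" by (intro borel_closed closed_Ints)
  have "emeasure (conv_pow K (n + 1)) \<int> = (\<integral>\<^sup>+t. indicator \<int> t \<partial>conv_pow K (n + 1))"
    by (subst nn_integral_indicator) auto
  also have "\<dots> = (\<integral>\<^sup>+x. \<integral>\<^sup>+y. indicator \<int> (x + y) \<partial>conv_pow K 1 \<partial>conv_pow K n)"
    by (rule nn_integral_conv_pow_add) auto
  also have "\<dots> = (\<integral>\<^sup>+x. 0 \<partial>conv_pow K n)"
  proof (rule nn_integral_cong)
    fix x :: real
    have "AE y in lborel. x + y \<notin> \<int>"
    proof (rule AE_I')
      have "{y. x + y \<in> \<int>} \<subseteq> (\<lambda>z. z - x) ` \<int>"
        by (auto intro!: image_eqI[of _ _ "x + _"])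
      then show "{y. x + y \<in> \<int>} \<in> null_sets lborel"
        by (intro countable_imp_null_set_lborel) (metis countable_int countable_image countable_subset Ints_def UNIV_I uncountable_def countableI_type)
    qed auto
    then have "(\<integral>\<^sup>+y. F y * indicator \<int> (x + y) \<partial>lborel) = (\<integral>\<^sup>+y. 0 \<partial>(lborel::real measure))"
      by (intro nn_integral_cong_AE) (auto elim!: eventually_mono)
    then show "(\<integral>\<^sup>+y. indicator \<int> (x + y) \<partial>conv_pow K 1) = 0"
      unfolding conv_pow_1 by (simp add: K_density nn_integral_density)
  qed
  finally have "\<int> \<in> null_sets (conv_pow K (Suc n))" by (auto simp: null_sets_def)
  then show ?thesis by (rule AE_not_in)
qed

text \<open>For a point that is not an integer the indicator vanishes as soon as
  \<open>s / real N\<close> drops below its distance to the integers. Dominated convergence then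
  gives the limit for each fixed \<open>k\<close>, without a rate.\<close>

lemma integral_near_int_tendsto_0:
  assumes "1 \<le> k"
  shows "(\<lambda>N. \<integral>t. near_int (s / real N) t \<partial>conv_pow K k) \<longlonglongrightarrow> 0"
proof -
  interpret C: prob_space "conv_pow K k" by (rule prob_space_conv_pow)
  have "(\<lambda>N. \<integral>t. near_int (s / real N) t \<partial>conv_pow K k) \<longlonglongrightarrow> (\<integral>t. 0 \<partial>conv_pow K k)"
  proof (rule integral_dominated_convergence[where w="\<lambda>_. 1"])
    have "AE t in conv_pow K k. t \<notin> \<int>"
    proof -
      obtain n where "k = Suc n" using assms by (cases k) auto
      then show ?thesis using conv_pow_Ints_null[of n] by (simp only:)
    qed
    then show "AE t in conv_pow K k. (\<lambda>N. near_int (s / real N) t) \<longlonglongrightarrow> 0"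
    proof eventually_elim
      case (elim t)
      then have "0 < dist_nearest_int t"
        using dist_nearest_int_eq_0_iff[of t] dist_nearest_int_nonneg[of t] by linarith
      moreover have "(\<lambda>N. s / real N) \<longlonglongrightarrow> 0" by (rule lim_const_over_n)
      ultimately have "eventually (\<lambda>N. s / real N < dist_nearest_int t) sequentially"
        by (intro order_tendstoD)
      then have "eventually (\<lambda>N. near_int (s / real N) t = 0) sequentially"
        by eventually_elim (simp add: near_int_iff)
      then show ?case by (rule tendsto_eventually)
    qed
  qed auto
  then show ?thesis by simp
qed

lemma expectation_pairs_tendsto:
  assumes s: "0 \<le> s"
  shows "(\<lambda>N. 2 / real N * M.expectation (\<lambda>\<omega>. \<Sum>p\<in>index_pairs N. near_ind (s / real N) p \<omega>)) \<longlonglongrightarrow> 2 * s"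
proof -
  obtain C \<theta> where "ergodic_rate C \<theta>" using ergodic_rate_exists by blast
  then have C: "0 < C" "0 < \<theta>" "\<theta> < 1" and erg: "\<And>\<delta> n x. 0 \<le> \<delta> \<Longrightarrow> \<delta> < 1/2 \<Longrightarrow>
     \<bar>\<integral>t. near_int \<delta> (x + t) - 2 * \<delta> \<partial>conv_pow K n\<bar> \<le> C * \<theta> ^ n" unfolding ergodic_rate_def by blast+
  define e where "e = (\<lambda>k N. (\<integral>t. near_int (s / real N) t \<partial>conv_pow K k) - 2 * (s / real N))"
  \<comment> \<open>The errors for 1 \<le> k \<le> N, extended by 0 to an infinite series so that
    Tannery's theorem applies although the range of \<open>k\<close> grows with
    \<open>N\<close>.\<close>
  define a where "a = (\<lambda>k N. if k \<in> {1..N} then \<bar>e k N\<bar> else 0)"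
  have e_bound: "\<bar>e k N\<bar> \<le> C * \<theta> ^ k" if "2 * s < real N" for k N
  proof -
    have "s / real N < 1/2" using that s by (simp add: field_simps)
    then show ?thesis using erg[of "s / real N" k 0] s integral_near_int_minus_const[of k "s / real N" 0 "2 * (s / real N)"]
      by (simp add: e_def)
  qed
  have evN: "eventually (\<lambda>N. 2 * s < real N) sequentially" by real_asymp
  have lim_e: "(\<lambda>N. e k N) \<longlonglongrightarrow> 0" if "1 \<le> k" for k
  proof -
    have "(\<lambda>N. e k N) \<longlonglongrightarrow> 0 - 2 * 0" unfolding e_def
      by (intro tendsto_intros integral_near_int_tendsto_0 that lim_const_over_n)
    then show ?thesis by simp
  qed
  have "(\<lambda>N. suminf (\<lambda>k. a k N)) \<longlonglongrightarrow> suminf (\<lambda>k. 0 :: real)"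
  proof (rule tannerys_theorem[THEN conjunct2, THEN conjunct2])
    show "(\<lambda>N. a k N) \<longlonglongrightarrow> 0" for k
    proof (cases "1 \<le> k")
      case True
      from tendsto_rabs_zero[OF lim_e[OF this]] show ?thesis
        by (rule tendsto_0_le[where K=1]) (auto simp: a_def)
    qed (auto simp: a_def)
    \<comment> \<open>The ergodic bound requires s / N < 1/2, so the domination is uniform in
      \<open>k\<close> but only eventual in \<open>N\<close>.\<close>
    show "eventually (\<lambda>(k, N). norm (a k N) \<le> C * \<theta> ^ k) (at_top \<times>\<^sub>F sequentially)"
      unfolding eventually_prod_filter
      using e_bound C evN by (intro exI[of _ "\<lambda>_. True"] exI[of _ "\<lambda>N. 2 * s < real N"]) (auto simp: a_def)
    show "summable (\<lambda>k. C * \<theta> ^ k)" using C by (intro summable_mult summable_geometric) auto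
  qed auto
  moreover have "suminf (\<lambda>k. a k N) = (\<Sum>k=1..N. \<bar>e k N\<bar>)" for N
    by (subst suminf_finite[of "{1..N}"]) (auto simp: a_def)
  ultimately have lim_sum: "(\<lambda>N. \<Sum>k=1..N. \<bar>e k N\<bar>) \<longlonglongrightarrow> 0" by simp
  have "\<bar>2 / real N * M.expectation (\<lambda>\<omega>. \<Sum>p\<in>index_pairs N. near_ind (s / real N) p \<omega>) - 2 * s * (1 - 1 / real N)\<bar>
     \<le> 2 * (\<Sum>k=1..N. \<bar>e k N\<bar>)" if N: "1 \<le> N" for N
  proof -
    have "M.expectation (\<lambda>\<omega>. \<Sum>p\<in>index_pairs N. near_ind (s / real N) p \<omega>)
       = (\<Sum>p\<in>index_pairs N. M.expectation (near_ind (s / real N) p))"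
      by (intro Bochner_Integration.integral_sum integrable_near_ind) (auto simp: index_pairs_def)
    also have "\<dots> = (\<Sum>p\<in>index_pairs N. e (snd p - fst p) N + 2 * (s / real N))"
      by (intro sum.cong refl) (auto simp: expectation_near_ind e_def index_pairs_def)
    also have "\<dots> = (\<Sum>p\<in>index_pairs N. e (snd p - fst p) N) + real (card (index_pairs N)) * (2 * (s / real N))"
      by (simp add: sum.distrib)
    \<comment> \<open>The main term: after multiplication by 2 / N it becomes 2 s (1 - 1/N).\<close>
    also have "real (card (index_pairs N)) * (2 * (s / real N)) = s * (real N - 1)"
      using N by (simp add: card_index_pairs)
    finally have E: "2 / real N * M.expectation (\<lambda>\<omega>. \<Sum>p\<in>index_pairs N. near_ind (s / real N) p \<omega>) - 2 * s * (1 - 1 / real N)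
       = 2 / real N * (\<Sum>p\<in>index_pairs N. e (snd p - fst p) N)"
      using N by (simp add: field_simps)
    have "\<bar>\<Sum>p\<in>index_pairs N. e (snd p - fst p) N\<bar> \<le> (\<Sum>p\<in>index_pairs N. \<bar>e (snd p - fst p) N\<bar>)"
      by (rule sum_abs)
    also have "\<dots> = (\<Sum>j=1..N. \<Sum>i=1..<j. \<bar>e (j - i) N\<bar>)" by (simp add: sum_index_pairs)
    \<comment> \<open>For fixed \<open>j\<close> the differences \<open>j - i\<close> are distinct,
      so each \<open>k\<close> occurs at most once. The factor \<open>N\<close> from the sum over
      \<open>j\<close> is cancelled by the normalisation.\<close>
    also have "\<dots> \<le> (\<Sum>j=1..N. \<Sum>k=1..N. \<bar>e k N\<bar>)"
    proof (rule sum_mono)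
      fix j assume j: "j \<in> {1..N}"
      have "(\<Sum>i=1..<j. \<bar>e (j - i) N\<bar>) = (\<Sum>k\<in>(\<lambda>i. j - i) ` {1..<j}. \<bar>e k N\<bar>)"
        by (subst sum.reindex) (auto simp: inj_on_def)
      also have "\<dots> \<le> (\<Sum>k=1..N. \<bar>e k N\<bar>)" using j by (intro sum_mono2) auto
      finally show "(\<Sum>i=1..<j. \<bar>e (j - i) N\<bar>) \<le> (\<Sum>k=1..N. \<bar>e k N\<bar>)" .
    qed
    also have "\<dots> = real N * (\<Sum>k=1..N. \<bar>e k N\<bar>)" by simp
    finally have "2 / real N * \<bar>\<Sum>p\<in>index_pairs N. e (snd p - fst p) N\<bar> \<le> 2 / real N * (real N * (\<Sum>k=1..N. \<bar>e k N\<bar>))"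
      by (intro mult_left_mono) auto
    then show ?thesis using N unfolding E by (simp add: abs_mult)
  qed
  then have ev: "eventually (\<lambda>N. norm (2 / real N * M.expectation (\<lambda>\<omega>. \<Sum>p\<in>index_pairs N. near_ind (s / real N) p \<omega>) - 2 * s * (1 - 1 / real N))
     \<le> 2 * (\<Sum>k=1..N. \<bar>e k N\<bar>)) sequentially"
    by (intro eventually_sequentiallyI[of 1]) simp
  have "(\<lambda>N. 2 * (\<Sum>k=1..N. \<bar>e k N\<bar>)) \<longlonglongrightarrow> 2 * 0" by (intro tendsto_mult tendsto_const lim_sum)
  then have "(\<lambda>N. 2 * (\<Sum>k=1..N. \<bar>e k N\<bar>)) \<longlonglongrightarrow> 0" by simp
  from Lim_null_comparison[OF ev this] have "(\<lambda>N. 2 / real N * M.expectation (\<lambda>\<omega>. \<Sum>p\<in>index_pairs N. near_ind (s / real N) p \<omega>) - 2 * s * (1 - 1 / real N)) \<longlonglongrightarrow> 0" .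
  moreover have "(\<lambda>N. 2 * s * (1 - 1 / real N)) \<longlonglongrightarrow> 2 * s * (1 - 0)"
    by (intro tendsto_intros lim_const_over_n)
  ultimately show ?thesis using tendsto_add by fastforce
qed

end

section \<open>Moment bounds\<close>

text \<open>With r^(k+2) = \<theta>, the sequence m r^m tends to 0, hence so does its power m^(k+2)
  \<theta>^m. The two surplus factors \<open>m\<close> yield comparison with 1 / m^2.\<close>

lemma summable_power_times_geometric:
  fixes \<theta> :: real assumes "0 < \<theta>" "\<theta> < 1"
  shows "summable (\<lambda>m. real m ^ k * \<theta> ^ m)"
proof -
  define j where "j = k + 2"
  define r where "r = root j \<theta>"
  have r: "0 < r" "r < 1" "r ^ j = \<theta>"
    using assms by (auto simp: r_def j_def simp del: power_Suc add_2_eq_Suc')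
  have "(\<lambda>m. real m * r ^ m) \<longlonglongrightarrow> 0" using powser_times_n_limit_0[of r] r by simp
  from tendsto_power[OF this, of j] have "(\<lambda>m. (real m * r ^ m) ^ j) \<longlonglongrightarrow> 0" by (simp add: j_def)
  moreover have "(real m * r ^ m) ^ j = real m ^ j * \<theta> ^ m" for m
    unfolding r(3)[symmetric] by (simp add: power_mult_distrib mult.commute flip: power_mult)
  ultimately have "(\<lambda>m. real m ^ j * \<theta> ^ m) \<longlonglongrightarrow> 0" by simp
  then have "eventually (\<lambda>m. real m ^ j * \<theta> ^ m < 1) sequentially" by (intro order_tendstoD) auto
  then have "eventually (\<lambda>m. norm (real m ^ k * \<theta> ^ m) \<le> inverse (real m ^ 2)) sequentially"
    using eventually_ge_at_top[of 1]
  proof eventually_elim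
    case (elim m)
    then have "real m ^ k * \<theta> ^ m * real m ^ 2 \<le> 1" by (simp add: j_def power_add mult_ac power2_eq_square)
    then show ?case using elim assms by (simp add: field_simps)
  qed
  then show ?thesis by (rule summable_comparison_test_ev) (rule inverse_power_summable, simp)
qed

definition far_pairs :: "nat \<Rightarrow> nat \<Rightarrow> (nat \<times> nat) set" where
  "far_pairs N L = {p \<in> index_pairs N. fst p + L \<le> snd p}"

text \<open>Both endpoints differ from those of \<open>p\<close> by less than \<open>L\<close>.
  Truncated subtraction merely cuts the range at 0.\<close>

definition close_pairs :: "nat \<Rightarrow> nat \<times> nat \<Rightarrow> (nat \<times> nat) set" where
  "close_pairs L p = {fst p + 1 - L..<fst p + L} \<times> {snd p + 1 - L..<snd p + L}"

lemma far_pairs_subset: "far_pairs N L \<subseteq> index_pairs N"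
  by (auto simp: far_pairs_def)

lemma finite_far_pairs[simp]: "finite (far_pairs N L)"
  by (rule finite_subset[OF far_pairs_subset finite_index_pairs])

lemma card_close_pairs: "card (close_pairs L p) \<le> 4 * L ^ 2"
proof -
  have "card (close_pairs L p) = (fst p + L - (fst p + 1 - L)) * (snd p + L - (snd p + 1 - L))"
    by (simp add: close_pairs_def card_cartesian_product)
  also have "\<dots> \<le> (2 * L) * (2 * L)" by (intro mult_le_mono) auto
  finally show ?thesis by (simp add: power2_eq_square)
qed

lemma card_far_pairs: "card (far_pairs N L) \<le> N ^ 2"
proof -
  have "far_pairs N L \<subseteq> {1..N} \<times> {1..N}" by (auto simp: far_pairs_def index_pairs_def)
  then have "card (far_pairs N L) \<le> card ({1..N} \<times> {1..N})" by (intro card_mono) auto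
  then show ?thesis by (simp add: card_cartesian_product power2_eq_square)
qed

lemma card_not_far_pairs: "card (index_pairs N - far_pairs N L) \<le> N * L"
proof -
  have "index_pairs N - far_pairs N L \<subseteq> Sigma {1..N} (\<lambda>i. {i<..<i+L})"
    by (auto simp: far_pairs_def index_pairs_def)
  then have "card (index_pairs N - far_pairs N L) \<le> card (Sigma {1..N} (\<lambda>i. {i<..<i+L}))"
    by (intro card_mono finite_SigmaI) auto
  also have "\<dots> = (\<Sum>i=1..N. L - 1)" by (subst card_SigmaI) auto
  also have "\<dots> \<le> N * L" by simp
  finally show ?thesis .
qed

text \<open>If the left endpoints differ by at least \<open>L\<close>, the interval starting earlier
  has an initial stretch outside the other; likewise for the right endpoints and a final stretch.
  Where the intervals are disjoint, the stretch is cut off by the end of its own interval, and it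
  still has \<open>L\<close> steps because both pairs are far.\<close>

lemma private_block:
  assumes "p \<in> far_pairs N L" "q \<in> far_pairs N L" "q \<notin> close_pairs L p"
  shows "\<exists>J. L \<le> card J \<and> (J \<subseteq> {fst p..<snd p} \<and> J \<inter> {fst q..<snd q} = {} \<or>
                                J \<subseteq> {fst q..<snd q} \<and> J \<inter> {fst p..<snd p} = {})"
proof -
  have len: "fst p + L \<le> snd p" "fst q + L \<le> snd q" using assms by (auto simp: far_pairs_def)
  consider "fst p + L \<le> fst q" | "fst q + L \<le> fst p" | "snd p + L \<le> snd q" | "snd q + L \<le> snd p"
    using assms(3) by (cases q) (auto simp: close_pairs_def not_less)
  then show ?thesis
  proof cases
    case 1
    then show ?thesis using len by (intro exI[of _ "{fst p..<min (snd p) (fst q)}"]) auto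
  next
    case 2
    then show ?thesis using len by (intro exI[of _ "{fst q..<min (snd q) (fst p)}"]) auto
  next
    case 3
    then show ?thesis using len by (intro exI[of _ "{max (fst q) (snd p)..<snd q}"]) auto
  next
    case 4
    then show ?thesis using len by (intro exI[of _ "{max (fst p) (snd q)..<snd p}"]) auto
  qed
qed

context step_walk
begin

text \<open>The bound for one step holds for every shift, so it survives conditioning on all steps
  but the last.\<close>

lemma integral_near_int_conv_pow_le:
  assumes w: "\<And>x. (\<integral>t. near_int \<delta> (x + t) \<partial>K) \<le> w" and n: "1 \<le> n"
  shows "(\<integral>t. near_int \<delta> t \<partial>conv_pow K n) \<le> w"
proof -
  obtain m where m: "n = m + 1" using n by (metis add.commute le_Suc_ex)
  interpret C: prob_space "conv_pow K m" by (rule prob_space_conv_pow)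
  have "(\<integral>t. near_int \<delta> t \<partial>conv_pow K n) = (\<integral>x. \<integral>t. near_int \<delta> (x + t) \<partial>conv_pow K 1 \<partial>conv_pow K m)"
    unfolding m by (rule integral_conv_pow_add[where C=1]) auto
  also have "\<dots> = (\<integral>x. \<integral>t. near_int \<delta> (x + t) \<partial>K \<partial>conv_pow K m)" by (simp only: conv_pow_1)
  also have "\<dots> \<le> w"
  proof (rule C.integral_le_const)
    have "\<bar>\<integral>t. near_int \<delta> (x + t) \<partial>K\<bar> \<le> w" for x
      using w[of x] by (simp add: abs_of_nonneg Bochner_Integration.integral_nonneg)
    then show "integrable (conv_pow K m) (\<lambda>x. \<integral>t. near_int \<delta> (x + t) \<partial>K)"
      by (intro C.integrable_const_bound[of _ w] AE_I2) auto
  qed (use w in auto)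
  finally show ?thesis .
qed

text \<open>Centred at the mean under the uniform law, not under \<open>M\<close>. The bias is
  covered by the same exponential bound, so the expectation of a product can be estimated directly
  in place of a covariance.\<close>

definition centered :: "real \<Rightarrow> nat \<times> nat \<Rightarrow> 'a \<Rightarrow> real" where
  "centered \<delta> p \<omega> = near_ind \<delta> p \<omega> - 2 * \<delta>"

lemma abs_centered_le_1: "0 \<le> \<delta> \<Longrightarrow> \<delta> < 1/2 \<Longrightarrow> \<bar>centered \<delta> p \<omega>\<bar> \<le> 1"
  using near_ind_bounds[of \<delta> p \<omega>] unfolding centered_def by linarith

lemma measurable_centered: "1 \<le> fst p \<Longrightarrow> centered \<delta> p \<in> borel_measurable M"
  unfolding centered_def[abs_def] using measurable_near_ind by (intro borel_measurable_diff) auto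

lemma integrable_centered_mult:
  assumes "0 \<le> \<delta>" "\<delta> < 1/2" "1 \<le> fst p" "1 \<le> fst q"
  shows "integrable M (\<lambda>\<omega>. centered \<delta> p \<omega> * centered \<delta> q \<omega>)"
proof (rule M.integrable_const_bound[of _ 1])
  show "AE \<omega> in M. norm (centered \<delta> p \<omega> * centered \<delta> q \<omega>) \<le> 1"
    using assms by (intro AE_I2) (auto simp: abs_mult intro!: mult_le_one abs_centered_le_1)
  show "(\<lambda>\<omega>. centered \<delta> p \<omega> * centered \<delta> q \<omega>) \<in> borel_measurable M"
    using assms measurable_centered by (intro borel_measurable_times) auto
qed

lemma expectation_centered_private:
  assumes erg: "ergodic_rate C \<theta>" and \<delta>: "0 \<le> \<delta>" "\<delta> < 1/2" and pq: "1 \<le> fst p" "1 \<le> fst q"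
    and J: "J \<subseteq> {fst p..<snd p}" "J \<inter> {fst q..<snd q} = {}" "L \<le> card J"
  shows "\<bar>M.expectation (\<lambda>\<omega>. centered \<delta> p \<omega> * centered \<delta> q \<omega>)\<bar> \<le> C * \<theta> ^ L"
proof -
  have C: "0 < C" "0 < \<theta>" "\<theta> < 1" and erg': "\<And>n x.
     \<bar>\<integral>t. near_int \<delta> (x + t) - 2 * \<delta> \<partial>conv_pow K n\<bar> \<le> C * \<theta> ^ n"
    using erg \<delta> unfolding ergodic_rate_def by blast+
  have fJ: "finite J" using J by (auto intro: finite_subset)
  let ?A = "{fst p..<snd p} - J"
  let ?\<phi> = "\<lambda>t. near_int \<delta> t - 2 * \<delta>"
  have un: "J \<union> ?A = {fst p..<snd p}" using J by auto
  have b: "\<bar>?\<phi> t\<bar> \<le> 1" for t using near_int_bounds[of \<delta> t] \<delta> by linarith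
  have "\<theta> ^ card J \<le> \<theta> ^ L" using C J by (intro power_decreasing) auto
  then have "C * \<theta> ^ card J \<le> C * \<theta> ^ L" using C by simp
  then have eps: "\<bar>\<integral>t. ?\<phi> (x + t) \<partial>conv_pow K (card J)\<bar> \<le> C * \<theta> ^ L" for x
    using erg'[of "card J" x] by linarith
  have "\<bar>M.expectation (\<lambda>\<omega>. ?\<phi> (incr (J \<union> ?A) \<omega>) * ?\<phi> (incr {fst q..<snd q} \<omega>))\<bar> \<le> C * \<theta> ^ L"
    using fJ J pq b eps by (intro expectation_private_block) auto
  then show ?thesis unfolding un by (simp add: centered_def near_ind_def)
qed

text \<open>The bound for couples without a private block: the factor of \<open>p\<close> is
  estimated by 1 and the factor of \<open>q\<close> by its indicator plus
  \<open>2 * \<delta>\<close>.\<close>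

lemma expectation_centered_le:
  assumes \<delta>: "0 \<le> \<delta>" "\<delta> < 1/2" and pq: "1 \<le> fst p" "1 \<le> fst q" "fst q < snd q"
    and w: "\<And>x. (\<integral>t. near_int \<delta> (x + t) \<partial>K) \<le> w"
  shows "\<bar>M.expectation (\<lambda>\<omega>. centered \<delta> p \<omega> * centered \<delta> q \<omega>)\<bar> \<le> w + 2 * \<delta>"
proof -
  have "\<bar>M.expectation (\<lambda>\<omega>. centered \<delta> p \<omega> * centered \<delta> q \<omega>)\<bar>
      \<le> M.expectation (\<lambda>\<omega>. \<bar>centered \<delta> p \<omega> * centered \<delta> q \<omega>\<bar>)"
    by (rule integral_abs_bound)
  also have "\<dots> \<le> M.expectation (\<lambda>\<omega>. near_ind \<delta> q \<omega> + 2 * \<delta>)"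
  proof (rule integral_mono)
    fix \<omega>
    have "\<bar>centered \<delta> p \<omega> * centered \<delta> q \<omega>\<bar> \<le> 1 * \<bar>centered \<delta> q \<omega>\<bar>"
      unfolding abs_mult using abs_centered_le_1[OF \<delta>] by (intro mult_right_mono) auto
    also have "\<dots> \<le> near_ind \<delta> q \<omega> + 2 * \<delta>"
      using near_ind_bounds(1)[of \<delta> q \<omega>] \<delta>(1) by (simp add: centered_def abs_le_iff)
    finally show "\<bar>centered \<delta> p \<omega> * centered \<delta> q \<omega>\<bar> \<le> near_ind \<delta> q \<omega> + 2 * \<delta>" .
  qed (use integrable_centered_mult[OF \<delta> pq(1,2)] integrable_near_ind[OF pq(2)] in auto)
  also have "\<dots> = (\<integral>t. near_int \<delta> t \<partial>conv_pow K (snd q - fst q)) + 2 * \<delta>"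
    using integrable_near_ind[OF pq(2)] expectation_near_ind[OF pq(2)] M.prob_space by simp
  also have "\<dots> \<le> w + 2 * \<delta>"
    using integral_near_int_conv_pow_le[OF w, of "snd q - fst q"] pq by simp
  finally show ?thesis .
qed

text \<open>Expanding the square gives at most N^4 couples of far pairs, each of which receives the
  exponential bound. The weak bound is added only for couples that are close, and each of the at
  most N^2 far pairs has at most 4 L^2 close partners.\<close>

lemma second_moment_far:
  assumes erg: "ergodic_rate C \<theta>" and \<delta>: "0 \<le> \<delta>" "\<delta> < 1/2"
    and w: "\<And>x. (\<integral>t. near_int \<delta> (x + t) \<partial>K) \<le> w"
  shows "M.expectation (\<lambda>\<omega>. (\<Sum>p\<in>far_pairs N L. centered \<delta> p \<omega>)\<^sup>2)
     \<le> real N ^ 4 * (C * \<theta> ^ L) + real N ^ 2 * (4 * real L ^ 2 * (w + 2 * \<delta>))"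
    and "integrable M (\<lambda>\<omega>. (\<Sum>p\<in>far_pairs N L. centered \<delta> p \<omega>)\<^sup>2)"
proof -
  have C: "0 < C" "0 < \<theta>" using erg unfolding ergodic_rate_def by auto
  have fp: "1 \<le> fst p" "fst p < snd p" if "p \<in> far_pairs N L" for p
    using that by (auto simp: far_pairs_def index_pairs_def)
  have w0: "0 \<le> w" using order_trans[OF Bochner_Integration.integral_nonneg w[of 0]] by simp
  have sq: "(\<Sum>p\<in>far_pairs N L. centered \<delta> p \<omega>)\<^sup>2
     = (\<Sum>p\<in>far_pairs N L. \<Sum>q\<in>far_pairs N L. centered \<delta> p \<omega> * centered \<delta> q \<omega>)" for \<omega>
    by (simp add: power2_eq_square sum_product)
  have int: "integrable M (\<lambda>\<omega>. centered \<delta> p \<omega> * centered \<delta> q \<omega>)"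
    if "p \<in> far_pairs N L" "q \<in> far_pairs N L" for p q
    using integrable_centered_mult[OF \<delta> fp(1)[OF that(1)] fp(1)[OF that(2)]] .
  show "integrable M (\<lambda>\<omega>. (\<Sum>p\<in>far_pairs N L. centered \<delta> p \<omega>)\<^sup>2)"
    unfolding sq by (intro Bochner_Integration.integrable_sum int)
  have cov: "M.expectation (\<lambda>\<omega>. centered \<delta> p \<omega> * centered \<delta> q \<omega>)
      \<le> C * \<theta> ^ L + (if q \<in> close_pairs L p then w + 2 * \<delta> else 0)"
    if pq: "p \<in> far_pairs N L" "q \<in> far_pairs N L" for p q
  proof (cases "q \<in> close_pairs L p")
    case True
    have "M.expectation (\<lambda>\<omega>. centered \<delta> p \<omega> * centered \<delta> q \<omega>) \<le> w + 2 * \<delta>"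
      using expectation_centered_le[OF \<delta> fp(1)[OF pq(1)] fp[OF pq(2)] w] by linarith
    then show ?thesis using True C by (simp add: add_increasing)
  next
    case False
    have "\<bar>M.expectation (\<lambda>\<omega>. centered \<delta> p \<omega> * centered \<delta> q \<omega>)\<bar> \<le> C * \<theta> ^ L"
      using private_block[OF pq False]
    proof (elim exE conjE disjE)
      fix J assume "L \<le> card J" "J \<subseteq> {fst p..<snd p}" "J \<inter> {fst q..<snd q} = {}"
      then show ?thesis using expectation_centered_private[OF erg \<delta>, of p q J L] fp pq by auto
    next
      fix J assume "L \<le> card J" "J \<subseteq> {fst q..<snd q}" "J \<inter> {fst p..<snd p} = {}"
      then show ?thesis using expectation_centered_private[OF erg \<delta>, of q p J L] fp pq
        by (auto simp: mult.commute)
    qed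
    then show ?thesis using False by simp
  qed
  have "M.expectation (\<lambda>\<omega>. (\<Sum>p\<in>far_pairs N L. centered \<delta> p \<omega>)\<^sup>2)
    = (\<Sum>p\<in>far_pairs N L. \<Sum>q\<in>far_pairs N L. M.expectation (\<lambda>\<omega>. centered \<delta> p \<omega> * centered \<delta> q \<omega>))"
    unfolding sq using int by (simp add: Bochner_Integration.integral_sum Bochner_Integration.integrable_sum)
  also have "\<dots> \<le> (\<Sum>p\<in>far_pairs N L. \<Sum>q\<in>far_pairs N L. C * \<theta> ^ L + (if q \<in> close_pairs L p then w + 2 * \<delta> else 0))"
    by (intro sum_mono cov)
  also have "\<dots> \<le> (\<Sum>p\<in>far_pairs N L. real N ^ 2 * (C * \<theta> ^ L) + 4 * real L ^ 2 * (w + 2 * \<delta>))"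
  proof (rule sum_mono)
    fix p assume "p \<in> far_pairs N L"
    have "(\<Sum>q\<in>far_pairs N L. C * \<theta> ^ L) \<le> real N ^ 2 * (C * \<theta> ^ L)"
    proof -
      have "real (card (far_pairs N L)) \<le> real N ^ 2"
        using card_far_pairs[of N L] by (metis of_nat_le_iff of_nat_power)
      then have "real (card (far_pairs N L)) * (C * \<theta> ^ L) \<le> real N ^ 2 * (C * \<theta> ^ L)"
        using C by (intro mult_right_mono) auto
      then show ?thesis by simp
    qed
    moreover have "(\<Sum>q\<in>far_pairs N L. if q \<in> close_pairs L p then w + 2 * \<delta> else 0) \<le> 4 * real L ^ 2 * (w + 2 * \<delta>)"
    proof -
      have fc: "finite (close_pairs L p)" by (simp add: close_pairs_def)
      have "card (far_pairs N L \<inter> close_pairs L p) \<le> card (close_pairs L p)"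
        using fc by (intro card_mono) auto
      then have "card (far_pairs N L \<inter> close_pairs L p) \<le> 4 * L ^ 2" using card_close_pairs[of L p] by linarith
      then have "real (card (far_pairs N L \<inter> close_pairs L p)) \<le> real (4 * L ^ 2)" by (simp only: of_nat_le_iff)
      moreover have "(\<Sum>q\<in>far_pairs N L. if q \<in> close_pairs L p then w + 2 * \<delta> else 0)
          = real (card (far_pairs N L \<inter> close_pairs L p)) * (w + 2 * \<delta>)"
        by (subst sum.inter_restrict[symmetric]) auto
      ultimately show ?thesis using w0 \<delta> by (auto intro!: mult_right_mono)
    qed
    ultimately show "(\<Sum>q\<in>far_pairs N L. C * \<theta> ^ L + (if q \<in> close_pairs L p then w + 2 * \<delta> else 0))
       \<le> real N ^ 2 * (C * \<theta> ^ L) + 4 * real L ^ 2 * (w + 2 * \<delta>)"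
      unfolding sum.distrib by (rule add_mono)
  qed
  also have "\<dots> = real (card (far_pairs N L)) * (real N ^ 2 * (C * \<theta> ^ L) + 4 * real L ^ 2 * (w + 2 * \<delta>))"
    by simp
  also have "\<dots> \<le> real N ^ 2 * (real N ^ 2 * (C * \<theta> ^ L) + 4 * real L ^ 2 * (w + 2 * \<delta>))"
  proof (rule mult_right_mono)
    show "real (card (far_pairs N L)) \<le> real N ^ 2"
      using card_far_pairs[of N L] by (metis of_nat_le_iff of_nat_power)
    show "0 \<le> real N ^ 2 * (C * \<theta> ^ L) + 4 * real L ^ 2 * (w + 2 * \<delta>)" using C w0 \<delta> by simp
  qed
  also have "\<dots> = real N ^ 4 * (C * \<theta> ^ L) + real N ^ 2 * (4 * real L ^ 2 * (w + 2 * \<delta>))"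
    by (simp add: algebra_simps power2_eq_square power4_eq_xxxx)
  finally show "M.expectation (\<lambda>\<omega>. (\<Sum>p\<in>far_pairs N L. centered \<delta> p \<omega>)\<^sup>2)
     \<le> real N ^ 4 * (C * \<theta> ^ L) + real N ^ 2 * (4 * real L ^ 2 * (w + 2 * \<delta>))" .
qed

text \<open>Pairs joined by fewer than \<open>L\<close> steps have not mixed, but there are at most
  \<open>N * L\<close> of them, so their expected number is small enough once \<open>w\<close>
  decays at a power rate.\<close>

lemma first_moment_not_far:
  assumes w: "\<And>x. (\<integral>t. near_int \<delta> (x + t) \<partial>K) \<le> w"
  shows "M.expectation (\<lambda>\<omega>. \<Sum>p\<in>index_pairs N - far_pairs N L. near_ind \<delta> p \<omega>) \<le> real N * real L * w"
    and "integrable M (\<lambda>\<omega>. \<Sum>p\<in>index_pairs N - far_pairs N L. near_ind \<delta> p \<omega>)"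
proof -
  let ?S = "index_pairs N - far_pairs N L"
  have w0: "0 \<le> w" using order_trans[OF Bochner_Integration.integral_nonneg w[of 0]] by simp
  have fp: "1 \<le> fst p" "fst p < snd p" if "p \<in> ?S" for p
    using that by (auto simp: index_pairs_def)
  show "integrable M (\<lambda>\<omega>. \<Sum>p\<in>?S. near_ind \<delta> p \<omega>)"
    using fp by (intro Bochner_Integration.integrable_sum integrable_near_ind)
  have "M.expectation (\<lambda>\<omega>. \<Sum>p\<in>?S. near_ind \<delta> p \<omega>) = (\<Sum>p\<in>?S. M.expectation (near_ind \<delta> p))"
    using fp by (intro Bochner_Integration.integral_sum integrable_near_ind)
  also have "\<dots> \<le> (\<Sum>p\<in>?S. w)"
  proof (rule sum_mono)
    fix p assume "p \<in> ?S"
    from fp[OF this] show "M.expectation (near_ind \<delta> p) \<le> w"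
      by (subst expectation_near_ind) (auto intro!: integral_near_int_conv_pow_le w)
  qed
  also have "\<dots> = real (card ?S) * w" by simp
  also have "\<dots> \<le> real (N * L) * w"
    using card_not_far_pairs[of N L] w0 by (intro mult_right_mono) (auto simp only: of_nat_le_iff)
  finally show "M.expectation (\<lambda>\<omega>. \<Sum>p\<in>?S. near_ind \<delta> p \<omega>) \<le> real N * real L * w" by simp
qed

text \<open>With \<open>N = m ^ A\<close> points and long pairs being those at index distance at least \<open>m\<close>, both moment
  bounds are summable in \<open>m\<close>.\<close>

lemma AE_tendsto_along_powers:
  fixes A :: nat
  assumes \<gamma>: "0 < \<gamma>" and holder: "\<And>\<delta> x. 0 < \<delta> \<Longrightarrow> \<delta> < 1/2 \<Longrightarrow> (\<integral>t. near_int \<delta> (x + t) \<partial>K) \<le> B * \<delta> powr \<gamma>"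
    and A: "4 \<le> A" "4 \<le> real A * \<gamma>" and s: "0 < s"
  shows "AE \<omega> in M. (\<lambda>m. 2 / real (m ^ A) * (\<Sum>p\<in>index_pairs (m ^ A). near_ind (s / real (m ^ A)) p \<omega>)) \<longlonglongrightarrow> 2 * s"
proof -
  obtain C \<theta> where erg: "ergodic_rate C \<theta>" using ergodic_rate_exists by blast
  then have C: "0 < C" "0 < \<theta>" "\<theta> < 1" unfolding ergodic_rate_def by auto
  have B: "0 \<le> B"
  proof -
    have "0 \<le> (\<integral>t. near_int (1/4) (0 + t) \<partial>K)" by (intro Bochner_Integration.integral_nonneg) simp
    also have "\<dots> \<le> B * (1/4) powr \<gamma>" by (rule holder) auto
    finally have "0 \<le> B * (1/4) powr \<gamma>" .
    then show ?thesis by (simp add: zero_le_mult_iff)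
  qed
  define n where "n = (\<lambda>m::nat. m ^ A)"
  define \<delta> where "\<delta> = (\<lambda>m. s / real (n m))"
  define w where "w = (\<lambda>m. B * \<delta> m powr \<gamma>)"
  define far where "far = (\<lambda>m \<omega>. 2 / real (n m) * (\<Sum>p\<in>far_pairs (n m) m. centered (\<delta> m) p \<omega>))"
  define close where "close = (\<lambda>m \<omega>. 2 / real (n m) * (\<Sum>p\<in>index_pairs (n m) - far_pairs (n m) m. near_ind (\<delta> m) p \<omega>))"
  \<comment> \<open>A nonnegative quantity that controls both random parts of the count, so that a
    single summability argument makes both tend to 0.\<close>
  define W where "W = (\<lambda>m \<omega>. close m \<omega> + (far m \<omega>)\<^sup>2)"
  define c where "c = B * s powr \<gamma> + 2 * s"
  have c: "0 \<le> c" "B * s powr \<gamma> \<le> c" using B s by (auto simp: c_def)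
  have close0: "0 \<le> close m \<omega>" for m \<omega> unfolding close_def
    by (intro mult_nonneg_nonneg sum_nonneg) auto
  have mn: "real m ^ 4 \<le> real (n m)" if "1 \<le> m" for m
  proof -
    have "real m ^ 4 \<le> real m ^ A" using that A by (intro power_increasing) auto
    then show ?thesis by (simp add: n_def)
  qed
  have ev_small: "eventually (\<lambda>m. \<delta> m < 1/2) sequentially"
  proof -
    have "eventually (\<lambda>m::nat. 2 * s < real m) sequentially" by real_asymp
    then show ?thesis using eventually_ge_at_top[of 1]
    proof eventually_elim
      case (elim m)
      have "real m \<le> real m ^ 4" using elim by (intro self_le_power) auto
      then have "2 * s < real (n m)" using elim mn[of m] by linarith
      moreover have "0 < real (n m)" using elim by (simp add: n_def)
      ultimately show ?case by (simp add: \<delta>_def field_simps)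
    qed
  qed
  have intW: "integrable M (W m)" for m
  proof -
    have "integrable M (close m)"
    proof -
      have "integrable M (\<lambda>\<omega>. \<Sum>p\<in>index_pairs (n m) - far_pairs (n m) m. near_ind (\<delta> m) p \<omega>)"
        by (intro Bochner_Integration.integrable_sum integrable_near_ind) (auto simp: index_pairs_def)
      then show ?thesis unfolding close_def by (rule integrable_mult_right)
    qed
    \<comment> \<open>Integrability is required for every \<open>m\<close>, also for small
      \<open>m\<close> where \<open>\<delta> m\<close> may be 1/2 or more; there the centred
      variables are bounded by \<open>1 + 2 * \<bar>\<delta> m\<bar>\<close> and not by 1.\<close>
    moreover have "integrable M (\<lambda>\<omega>. (far m \<omega>)\<^sup>2)"
    proof -
      have ic: "integrable M (\<lambda>\<omega>. centered (\<delta> m) p \<omega> * centered (\<delta> m) q \<omega>)"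
        if "p \<in> far_pairs (n m) m" "q \<in> far_pairs (n m) m" for p q
      proof (rule M.integrable_const_bound[of _ "(1 + 2 * \<bar>\<delta> m\<bar>) * (1 + 2 * \<bar>\<delta> m\<bar>)"])
        have cb: "\<bar>centered (\<delta> m) r \<omega>\<bar> \<le> 1 + 2 * \<bar>\<delta> m\<bar>" for r \<omega>
          using near_ind_bounds[of "\<delta> m" r \<omega>] unfolding centered_def by arith
        show "AE \<omega> in M. norm (centered (\<delta> m) p \<omega> * centered (\<delta> m) q \<omega>) \<le> (1 + 2 * \<bar>\<delta> m\<bar>) * (1 + 2 * \<bar>\<delta> m\<bar>)"
          unfolding real_norm_def abs_mult by (intro AE_I2 mult_mono cb) auto
        show "(\<lambda>\<omega>. centered (\<delta> m) p \<omega> * centered (\<delta> m) q \<omega>) \<in> borel_measurable M"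
          using that measurable_centered by (intro borel_measurable_times) (auto simp: far_pairs_def index_pairs_def)
      qed
      have "(far m \<omega>)\<^sup>2 = (2 / real (n m))\<^sup>2 * (\<Sum>p\<in>far_pairs (n m) m. \<Sum>q\<in>far_pairs (n m) m. centered (\<delta> m) p \<omega> * centered (\<delta> m) q \<omega>)" for \<omega>
        by (simp add: far_def power_mult_distrib power2_eq_square sum_product)
      moreover have "integrable M (\<lambda>\<omega>. (2 / real (n m))\<^sup>2 * (\<Sum>p\<in>far_pairs (n m) m. \<Sum>q\<in>far_pairs (n m) m. centered (\<delta> m) p \<omega> * centered (\<delta> m) q \<omega>))"
        by (intro integrable_mult_right Bochner_Integration.integrable_sum ic)
      ultimately show ?thesis by simp
    qed
    ultimately show ?thesis unfolding W_def by (rule Bochner_Integration.integrable_add)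
  qed
  have W0: "0 \<le> W m \<omega>" for m \<omega> using close0 by (simp add: W_def)
  have EW: "M.expectation (W m) \<le> 2 * (c * inverse (real m ^ 2)) + 4 * C * (real m ^ (2 * A) * \<theta> ^ m) + 16 * (2 * c * inverse (real m ^ 2))"
    if m: "1 \<le> m" and small: "\<delta> m < 1/2" for m
  proof -
    have npos: "0 < real (n m)" using m by (simp add: n_def)
    have \<delta>pos: "0 < \<delta> m" using npos s by (simp add: \<delta>_def)
    have hw: "(\<integral>t. near_int (\<delta> m) (x + t) \<partial>K) \<le> w m" for x
      unfolding w_def by (rule holder[OF \<delta>pos small])
    have mp: "0 < real m" using m by simp
    \<comment> \<open>The exponent 4 is what the far part asks for: the close couples contribute m^2
      (w + 2 \<delta>), which must be summable. It comes from \<delta> = s m^(-A) together with A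
      \<gamma> \<ge> 4; for \<delta> itself A \<ge> 4 plays this part. The constant \<open>c\<close>
      serves both estimates.\<close>
    have w_le: "w m \<le> c * inverse (real m ^ 4)"
    proof -
      have "\<delta> m powr \<gamma> = s powr \<gamma> * real m powr (- (real A * \<gamma>))"
      proof -
        have "\<delta> m = s * real m powr (- real A)"
          using mp by (simp add: \<delta>_def n_def powr_minus powr_realpow divide_inverse)
        then show ?thesis using s mp by (simp add: powr_mult powr_powr)
      qed
      also have "\<dots> \<le> s powr \<gamma> * real m powr (- 4)"
        using A m by (intro mult_left_mono powr_mono) auto
      also have "real m powr (- 4) = inverse (real m ^ 4)"
        using mp by (simp add: powr_minus)
      finally have "w m \<le> B * (s powr \<gamma> * inverse (real m ^ 4))"
        unfolding w_def using B by (intro mult_left_mono)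
      also have "\<dots> \<le> c * inverse (real m ^ 4)"
        unfolding mult.assoc[symmetric] using c mp by (intro mult_right_mono) auto
      finally show ?thesis .
    qed
    have \<delta>_le: "2 * \<delta> m \<le> c * inverse (real m ^ 4)"
    proof -
      have "2 * \<delta> m \<le> 2 * s / real m ^ 4"
        using mn[OF m] s mp npos by (simp add: \<delta>_def frac_le)
      also have "\<dots> \<le> c / real m ^ 4"
        using B by (intro divide_right_mono) (auto simp: c_def)
      finally show ?thesis by (simp add: divide_inverse)
    qed
    have w0: "0 \<le> w m" using B by (simp add: w_def)
    have inv: "real m * inverse (real m ^ 4) \<le> inverse (real m ^ 2)"
      "real m ^ 2 * inverse (real m ^ 4) = inverse (real m ^ 2)"
    proof -
      show "real m ^ 2 * inverse (real m ^ 4) = inverse (real m ^ 2)"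
        using mp by (simp add: field_simps power2_eq_square power4_eq_xxxx)
      have "real m * inverse (real m ^ 4) \<le> real m ^ 2 * inverse (real m ^ 4)"
        using m by (intro mult_right_mono self_le_power) auto
      then show "real m * inverse (real m ^ 4) \<le> inverse (real m ^ 2)"
        using \<open>real m ^ 2 * inverse (real m ^ 4) = _\<close> by simp
    qed
    have "M.expectation (close m) \<le> 2 / real (n m) * (real (n m) * real m * w m)"
    proof -
      have "M.expectation (close m) = 2 / real (n m) *
          M.expectation (\<lambda>\<omega>. \<Sum>p\<in>index_pairs (n m) - far_pairs (n m) m. near_ind (\<delta> m) p \<omega>)"
        unfolding close_def by (rule integral_mult_right_zero)
      also have "\<dots> \<le> 2 / real (n m) * (real (n m) * real m * w m)"
        by (intro mult_left_mono first_moment_not_far(1) hw) simp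
      finally show ?thesis .
    qed
    also have "\<dots> = 2 * (real m * w m)" using npos by simp
    also have "\<dots> \<le> 2 * (real m * (c * inverse (real m ^ 4)))"
      using w_le by (intro mult_left_mono) auto
    also have "\<dots> = 2 * (c * (real m * inverse (real m ^ 4)))" by simp
    also have "\<dots> \<le> 2 * (c * inverse (real m ^ 2))"
      using inv c by (intro mult_left_mono) auto
    finally have E1: "M.expectation (close m) \<le> 2 * (c * inverse (real m ^ 2))" .
    let ?S = "\<lambda>\<omega>. (\<Sum>p\<in>far_pairs (n m) m. centered (\<delta> m) p \<omega>)\<^sup>2"
    have "(\<lambda>\<omega>. (far m \<omega>)\<^sup>2) = (\<lambda>\<omega>. 4 / real (n m) ^ 2 * ?S \<omega>)"
      by (auto simp: far_def power_mult_distrib power_divide)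
    then have "M.expectation (\<lambda>\<omega>. (far m \<omega>)\<^sup>2) = 4 / real (n m) ^ 2 * M.expectation ?S"
      by simp
    also have "\<dots> \<le> 4 / real (n m) ^ 2 * (real (n m) ^ 4 * (C * \<theta> ^ m) + real (n m) ^ 2 * (4 * real m ^ 2 * (w m + 2 * \<delta> m)))"
      using second_moment_far(1)[OF erg _ small hw, of "n m" m] \<delta>pos by (intro mult_left_mono) auto
    also have "\<dots> = 4 * C * (real (n m) ^ 2 * \<theta> ^ m) + 16 * (real m ^ 2 * (w m + 2 * \<delta> m))"
      using npos by (simp add: field_simps power2_eq_square power4_eq_xxxx)
    also have "real (n m) ^ 2 = real m ^ (2 * A)" by (simp add: n_def power_mult[symmetric] mult.commute)
    also have "real m ^ 2 * (w m + 2 * \<delta> m) \<le> real m ^ 2 * (2 * c * inverse (real m ^ 4))"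
      using w_le \<delta>_le by (intro mult_left_mono) auto
    also have "\<dots> = 2 * c * (real m ^ 2 * inverse (real m ^ 4))" by simp
    also have "\<dots> = 2 * c * inverse (real m ^ 2)" by (simp only: inv)
    finally have E2: "M.expectation (\<lambda>\<omega>. (far m \<omega>)\<^sup>2) \<le> 4 * C * (real m ^ (2 * A) * \<theta> ^ m) + 16 * (2 * c * inverse (real m ^ 2))"
      by simp
    have i1: "integrable M (close m)"
      unfolding close_def using first_moment_not_far(2)[OF hw, of "n m" m] by (rule integrable_mult_right)
    have i2: "integrable M (\<lambda>\<omega>. (far m \<omega>)\<^sup>2)"
      using Bochner_Integration.integrable_diff[OF intW[of m] i1] by (simp add: W_def)
    have "M.expectation (W m) = M.expectation (close m) + M.expectation (\<lambda>\<omega>. (far m \<omega>)\<^sup>2)"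
      unfolding W_def by (rule Bochner_Integration.integral_add[OF i1 i2])
    then show ?thesis using E1 E2 by linarith
  qed
  have sumW: "summable (\<lambda>m. M.expectation (W m))"
  proof (rule summable_comparison_test_ev)
    show "eventually (\<lambda>m. norm (M.expectation (W m)) \<le> 2 * (c * inverse (real m ^ 2)) + 4 * C * (real m ^ (2 * A) * \<theta> ^ m) + 16 * (2 * c * inverse (real m ^ 2))) sequentially"
      using ev_small eventually_ge_at_top[of 1]
    proof eventually_elim
      case (elim m)
      then show ?case using EW[of m] Bochner_Integration.integral_nonneg[of M "W m"] W0 by simp
    qed
    show "summable (\<lambda>m. 2 * (c * inverse (real m ^ 2)) + 4 * C * (real m ^ (2 * A) * \<theta> ^ m) + 16 * (2 * c * inverse (real m ^ 2)))"
      by (intro summable_add summable_mult summable_power_times_geometric C inverse_power_summable) simp_all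
  qed
  have "AE \<omega> in M. (\<lambda>m. W m \<omega>) \<longlonglongrightarrow> 0"
    by (rule M.AE_tendsto_0_if_summable_expectation[OF intW W0 sumW])
  then show ?thesis
  proof eventually_elim
    case (elim \<omega>)
    have close_lim: "(\<lambda>m. close m \<omega>) \<longlonglongrightarrow> 0"
      by (rule tendsto_sandwich[OF _ _ tendsto_const elim]) (auto simp: close0 W_def)
    have "(\<lambda>m. sqrt (W m \<omega>)) \<longlonglongrightarrow> 0" using tendsto_real_sqrt[OF elim] by simp
    then have far_lim: "(\<lambda>m. far m \<omega>) \<longlonglongrightarrow> 0"
    proof (rule Lim_null_comparison[rotated], intro always_eventually allI)
      fix m
      have "\<bar>far m \<omega>\<bar> = sqrt ((far m \<omega>)\<^sup>2)" by simp
      also have "\<dots> \<le> sqrt (W m \<omega>)"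
        by (intro real_sqrt_le_mono) (simp add: W_def close0)
      finally show "norm (far m \<omega>) \<le> sqrt (W m \<omega>)" by simp
    qed
    \<comment> \<open>What the subtracted means \<open>2 * \<delta> m\<close> add up to over the far
      pairs, after normalisation.\<close>
    define det where "det = (\<lambda>m. 2 / real (n m) * (real (card (far_pairs (n m) m)) * (2 * \<delta> m)))"
    have det_lim: "det \<longlonglongrightarrow> 2 * s"
    proof -
      \<comment> \<open>Over all pairs the means would give exactly 2 s (1 - 1/n). Leaving out at
        most n m pairs changes this by at most 4 s m / n, which n \<ge> m^4 makes
        negligible.\<close>
      have bound: "norm (det m - 2 * s * (1 - 1 / real (n m))) \<le> 4 * s / real m" if m: "1 \<le> m" for m
      proof -
        have npos: "0 < real (n m)" using m by (simp add: n_def)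
        have "card (index_pairs (n m)) = card (far_pairs (n m) m) + card (index_pairs (n m) - far_pairs (n m) m)"
          by (metis card_Diff_subset card_mono finite_far_pairs finite_index_pairs far_pairs_subset le_add_diff_inverse)
        then have cf: "real (card (far_pairs (n m) m)) = real (n m) * (real (n m) - 1) / 2 - real (card (index_pairs (n m) - far_pairs (n m) m))"
          using card_index_pairs[of "n m"] by simp
        have "det m - 2 * s * (1 - 1 / real (n m)) = - (4 * s / (real (n m) * real (n m)) * real (card (index_pairs (n m) - far_pairs (n m) m)))"
          unfolding det_def \<delta>_def cf using npos by (simp add: field_simps)
        then have "norm (det m - 2 * s * (1 - 1 / real (n m))) = 4 * s / (real (n m) * real (n m)) * real (card (index_pairs (n m) - far_pairs (n m) m))"
          using s by (simp add: abs_mult)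
        also have "\<dots> \<le> 4 * s / (real (n m) * real (n m)) * real (n m * m)"
          using card_not_far_pairs[of "n m" m] s by (intro mult_left_mono) (auto simp only: of_nat_le_iff, auto)
        also have "\<dots> = 4 * s * (real m / real (n m))" using npos by simp
        also have "\<dots> \<le> 4 * s * (real m / real m ^ 4)"
          using mn[OF m] m s npos by (intro mult_left_mono divide_left_mono) auto
        also have "\<dots> \<le> 4 * s * (1 / real m)"
        proof -
          have "real m * real m \<le> real m ^ 4" using m power_increasing[of 2 4 "real m"] by (simp add: power2_eq_square)
          then show ?thesis using m s by (intro mult_left_mono) (auto simp: field_simps)
        qed
        finally show ?thesis by simp
      qed
      have "(\<lambda>m::nat. 4 * s / real m) \<longlonglongrightarrow> 0" by (rule lim_const_over_n)
      from Lim_null_comparison[OF eventually_sequentiallyI[of 1, OF bound] this]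
      have "(\<lambda>m. det m - 2 * s * (1 - 1 / real (n m))) \<longlonglongrightarrow> 0" .
      moreover have "(\<lambda>m. 2 * s * (1 - 1 / real (n m))) \<longlonglongrightarrow> 2 * s * (1 - 0)"
      proof (intro tendsto_intros)
        have "filterlim n at_top sequentially"
          unfolding filterlim_at_top
        proof
          fix Z
          show "eventually (\<lambda>m. Z \<le> n m) sequentially"
          proof (rule eventually_sequentiallyI[of "Z + 1"])
            fix m assume "Z + 1 \<le> m"
            moreover have "m \<le> n m" unfolding n_def using A \<open>Z + 1 \<le> m\<close> by (intro self_le_power) auto
            ultimately show "Z \<le> n m" by linarith
          qed
        qed
        from filterlim_compose[OF lim_const_over_n this, of 1]
        show "(\<lambda>m. 1 / real (n m)) \<longlonglongrightarrow> 0" by simp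
      qed
      ultimately have "(\<lambda>m. (det m - 2 * s * (1 - 1 / real (n m))) + 2 * s * (1 - 1 / real (n m))) \<longlonglongrightarrow> 0 + 2 * s * (1 - 0)"
        by (rule tendsto_add)
      then show ?thesis by simp
    qed
    have split: "2 / real (n m) * (\<Sum>p\<in>index_pairs (n m). near_ind (\<delta> m) p \<omega>) = close m \<omega> + far m \<omega> + det m" for m
    proof -
      have "(\<Sum>p\<in>index_pairs (n m). near_ind (\<delta> m) p \<omega>)
        = (\<Sum>p\<in>index_pairs (n m) - far_pairs (n m) m. near_ind (\<delta> m) p \<omega>) + (\<Sum>p\<in>far_pairs (n m) m. near_ind (\<delta> m) p \<omega>)"
        by (rule sum.subset_diff[OF far_pairs_subset finite_index_pairs])
      also have "(\<Sum>p\<in>far_pairs (n m) m. near_ind (\<delta> m) p \<omega>) = (\<Sum>p\<in>far_pairs (n m) m. centered (\<delta> m) p \<omega>) + real (card (far_pairs (n m) m)) * (2 * \<delta> m)"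
        by (simp add: centered_def sum_subtractf)
      finally show ?thesis by (simp add: close_def far_def det_def algebra_simps)
    qed
    have "(\<lambda>m. close m \<omega> + far m \<omega> + det m) \<longlonglongrightarrow> 0 + 0 + 2 * s"
      by (intro tendsto_add close_lim far_lim det_lim)
    then show ?case unfolding split[symmetric] by (simp add: n_def \<delta>_def)
  qed
qed

end

section \<open>Step distributions with a density\<close>

text \<open>Above the level \<open>T\<close>, the negative exponent gives y^(1-q) \<le>
  T^(1-q).\<close>

lemma powr_split_bound:
  fixes y T q :: real
  assumes "0 \<le> y" "0 < T" "1 < q"
  shows "y \<le> T + y powr q * T powr (1 - q)"
proof (cases "y \<le> T")
  case True
  then show ?thesis using assms by (simp add: add_increasing2)
next
  case False
  then have y: "0 < y" "T \<le> y" using assms by auto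
  have "y = y powr q * y powr (1 - q)" using y by (simp flip: powr_add)
  also have "\<dots> \<le> y powr q * T powr (1 - q)"
    using y assms by (intro mult_left_mono powr_mono2') auto
  finally show ?thesis using assms by linarith
qed

text \<open>Reduces all p > 1 to a finite exponent: an essentially bounded function on a probability
  space has an integrable square, and a finite p is itself the exponent.\<close>

lemma Lp_unit_real_exponent:
  assumes f: "f \<in> Lp p lborel_unit" and p: "1 < p"
  shows "\<exists>q>1. integrable lborel_unit (\<lambda>t. \<bar>f t\<bar> powr q)"
proof (cases "p = \<infinity>")
  case True
  interpret U: prob_space lborel_unit by (rule prob_space_unit)
  have fm[measurable]: "f \<in> borel_measurable lborel_unit" and "esssup lborel_unit (\<lambda>t. ereal \<bar>f t\<bar>) < \<infinity>"
    using f True by (auto simp: Lp_def)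
  then obtain B where B: "esssup lborel_unit (\<lambda>t. ereal \<bar>f t\<bar>) \<le> ereal B"
    by (cases "esssup lborel_unit (\<lambda>t. ereal \<bar>f t\<bar>)") auto
  have "AE t in lborel_unit. ereal \<bar>f t\<bar> \<le> esssup lborel_unit (\<lambda>t. ereal \<bar>f t\<bar>)"
    by (rule esssup_AE)
  then have "AE t in lborel_unit. norm (\<bar>f t\<bar> powr 2) \<le> B powr 2"
  proof eventually_elim
    case (elim t)
    then have "\<bar>f t\<bar> \<le> B" using B order_trans by force
    then show ?case using powr_mono2[of 2 "\<bar>f t\<bar>" B] by simp
  qed
  then have "integrable lborel_unit (\<lambda>t. \<bar>f t\<bar> powr 2)"
    by (intro U.integrable_const_bound[of _ "B powr 2"]) auto
  then show ?thesis by (intro exI[of _ 2]) auto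
next
  case False
  then have "1 < enn2real p" using p by (cases p) (auto simp flip: ennreal_1 simp: ennreal_less_iff)
  then show ?thesis using f False by (auto simp: Lp_def)
qed

text \<open>Transfer from \<open>D\<close>, whose underlying space is [0,1), to a Borel law on the
  whole line, where sums of steps and convolutions live. The density is extended by 0.\<close>

lemma step_law_density:
  assumes f[measurable]: "f \<in> borel_measurable lborel_unit" and D: "D = density lborel_unit (\<lambda>t. ennreal (f t))"
  shows "(\<lambda>t. ennreal (indicator {0..<1} t * f t)) \<in> borel_measurable borel"
    and "distr D borel (\<lambda>t. t) = density lborel (\<lambda>t. ennreal (indicator {0..<1} t * f t))"
    and "\<And>\<phi>. \<phi> \<in> borel_measurable borel \<Longrightarrow> (\<integral>\<^sup>+t. \<phi> t \<partial>distr D borel (\<lambda>t. t)) = (\<integral>\<^sup>+t. ennreal (f t) * \<phi> t \<partial>lborel_unit)"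
proof -
  have "(\<lambda>t. indicator {0..<1} t *\<^sub>R f t) \<in> borel_measurable lborel"
    using f by (subst (asm) borel_measurable_restrict_space_iff) auto
  then show m[measurable]: "(\<lambda>t. ennreal (indicator {0..<1} t * f t)) \<in> borel_measurable borel" by simp
  have idm: "(\<lambda>t. t) \<in> measurable D borel" "(\<lambda>t. t) \<in> measurable lborel_unit borel"
    unfolding D by (auto intro!: measurable_unit)
  show int: "(\<integral>\<^sup>+t. \<phi> t \<partial>distr D borel (\<lambda>t. t)) = (\<integral>\<^sup>+t. ennreal (f t) * \<phi> t \<partial>lborel_unit)"
    if [measurable]: "\<phi> \<in> borel_measurable borel" for \<phi>
  proof -
    have "(\<integral>\<^sup>+t. \<phi> t \<partial>distr D borel (\<lambda>t. t)) = (\<integral>\<^sup>+t. \<phi> t \<partial>D)"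
      using idm by (intro nn_integral_distr) auto
    also have "\<dots> = (\<integral>\<^sup>+t. ennreal (f t) * \<phi> t \<partial>lborel_unit)"
      unfolding D using measurable_unit[OF that] by (intro nn_integral_density) auto
    finally show ?thesis .
  qed
  show "distr D borel (\<lambda>t. t) = density lborel (\<lambda>t. ennreal (indicator {0..<1} t * f t))"
  proof (rule measure_eqI)
    fix S assume "S \<in> sets (distr D borel (\<lambda>t. t))"
    then have S[measurable]: "S \<in> sets borel" by simp
    have "emeasure (distr D borel (\<lambda>t. t)) S = (\<integral>\<^sup>+t. indicator S t \<partial>distr D borel (\<lambda>t. t))" by simp
    also have "\<dots> = (\<integral>\<^sup>+t. ennreal (f t) * indicator S t \<partial>lborel_unit)" by (rule int) auto
    also have "\<dots> = (\<integral>\<^sup>+t. ennreal (f t) * indicator S t * indicator {0..<1} t \<partial>lborel)"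
      by (subst nn_integral_restrict_space) auto
    also have "\<dots> = (\<integral>\<^sup>+t. ennreal (indicator {0..<1} t * f t) * indicator S t \<partial>lborel)"
      by (intro nn_integral_cong) (auto split: split_indicator)
    also have "\<dots> = emeasure (density lborel (\<lambda>t. ennreal (indicator {0..<1} t * f t))) S"
      by (subst emeasure_density) auto
    finally show "emeasure (distr D borel (\<lambda>t. t)) S = \<dots>" .
  qed simp
qed

text \<open>The Hoelder exponent of the distribution function, obtained by truncating the density
  at level \<open>\<delta> powr (- 1 / q)\<close>.\<close>

lemma near_int_holder:
  assumes f[measurable]: "f \<in> borel_measurable lborel_unit" and D: "D = density lborel_unit (\<lambda>t. ennreal (f t))"
    and pos: "AE t in lborel_unit. 0 \<le> f t" and q: "1 < q" and int: "integrable lborel_unit (\<lambda>t. \<bar>f t\<bar> powr q)"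
  shows "\<exists>B. \<forall>\<delta> x. 0 < \<delta> \<longrightarrow> \<delta> < 1/2 \<longrightarrow>
     (\<integral>t. near_int \<delta> (x + t) \<partial>distr D borel (\<lambda>t. t)) \<le> B * \<delta> powr (1 - 1/q)"
proof -
  define I where "I = (\<integral>t. \<bar>f t\<bar> powr q \<partial>lborel_unit)"
  have I0: "0 \<le> I" by (simp add: I_def)
  have "(\<integral>t. near_int \<delta> (x + t) \<partial>distr D borel (\<lambda>t. t)) \<le> (2 + I) * \<delta> powr (1 - 1/q)"
    if \<delta>: "0 < \<delta>" "\<delta> < 1/2" for \<delta> x
  proof -
    \<comment> \<open>This level balances the two terms: below it the density contributes at most 2
      T \<delta>, above it at most T^(1-q) times the integral of f^q, and both T \<delta> and
      T^(1-q) equal \<delta>^(1 - 1/q).\<close>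
    define T where "T = \<delta> powr (- 1 / q)"
    have T: "0 < T" using \<delta> by (simp add: T_def)
    have T1: "T * \<delta> = \<delta> powr (1 - 1/q)" using \<delta> by (simp add: T_def powr_diff powr_minus field_simps)
    have T2: "T powr (1 - q) = \<delta> powr (1 - 1/q)"
    proof -
      have "- 1 / q * (1 - q) = 1 - 1 / q" using q by (simp add: field_simps)
      then show ?thesis unfolding T_def powr_powr by (simp only:)
    qed
    have [measurable]: "(\<lambda>t. t) \<in> measurable lborel_unit borel" by (intro measurable_unit) auto
    have "(\<integral>\<^sup>+t. ennreal (near_int \<delta> (x + t)) \<partial>distr D borel (\<lambda>t. t)) = (\<integral>\<^sup>+t. ennreal (f t) * ennreal (near_int \<delta> (x + t)) \<partial>lborel_unit)"
      by (rule step_law_density(3)[OF f D]) auto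
    also have "\<dots> \<le> (\<integral>\<^sup>+t. ennreal T * ennreal (near_int \<delta> (x + t)) + ennreal (T powr (1 - q)) * ennreal (\<bar>f t\<bar> powr q) \<partial>lborel_unit)"
    proof (rule nn_integral_mono_AE, use pos in eventually_elim)
      case (elim t)
      have "f t \<le> T + f t powr q * T powr (1 - q)" by (rule powr_split_bound[OF elim T q])
      then have "f t * near_int \<delta> (x + t) \<le> (T + f t powr q * T powr (1 - q)) * near_int \<delta> (x + t)"
        by (intro mult_right_mono) auto
      also have "\<dots> = T * near_int \<delta> (x + t) + T powr (1 - q) * \<bar>f t\<bar> powr q * near_int \<delta> (x + t)"
        using elim by (simp add: algebra_simps)
      also have "\<dots> \<le> T * near_int \<delta> (x + t) + T powr (1 - q) * \<bar>f t\<bar> powr q * 1"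
        by (intro add_left_mono mult_left_mono) auto
      finally have "ennreal (f t * near_int \<delta> (x + t)) \<le> ennreal (T * near_int \<delta> (x + t) + T powr (1 - q) * \<bar>f t\<bar> powr q)"
        by (intro ennreal_leI) simp
      then show ?case using elim T by (simp add: ennreal_mult ennreal_plus)
    qed
    also have "\<dots> = ennreal T * (\<integral>\<^sup>+t. ennreal (near_int \<delta> (x + t)) \<partial>lborel_unit) + ennreal (T powr (1 - q)) * (\<integral>\<^sup>+t. ennreal (\<bar>f t\<bar> powr q) \<partial>lborel_unit)"
      by (subst nn_integral_add) (auto simp: nn_integral_cmult)
    also have "(\<integral>\<^sup>+t. ennreal (near_int \<delta> (x + t)) \<partial>lborel_unit) = (\<integral>\<^sup>+t. ennreal (near_int \<delta> t) \<partial>lborel_unit)"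
      using periodic1_near_int[of \<delta>] by (intro nn_integral_unit_periodic_shift[where f="\<lambda>t. ennreal (near_int \<delta> t)"]) (auto simp: periodic1_def)
    also have "\<dots> = ennreal (2 * \<delta>)"
    proof -
      interpret U: prob_space lborel_unit by (rule prob_space_unit)
      have "integrable lborel_unit (near_int \<delta>)"
        by (intro U.integrable_const_bound[of _ 1] AE_I2 measurable_unit) auto
      then show ?thesis using integral_near_int[of \<delta>] \<delta> by (subst nn_integral_eq_integral) auto
    qed
    also have "(\<integral>\<^sup>+t. ennreal (\<bar>f t\<bar> powr q) \<partial>lborel_unit) = ennreal I"
      unfolding I_def by (rule nn_integral_eq_integral[OF int]) auto
    also have "ennreal T * ennreal (2 * \<delta>) + ennreal (T powr (1 - q)) * ennreal I = ennreal (T * (2 * \<delta>) + T powr (1 - q) * I)"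
      using T \<delta> I0 by (simp add: ennreal_mult ennreal_plus)
    also have "T * (2 * \<delta>) + T powr (1 - q) * I = (2 + I) * \<delta> powr (1 - 1/q)"
      unfolding T2 using T1 by (simp add: algebra_simps)
    finally have "(\<integral>\<^sup>+t. ennreal (near_int \<delta> (x + t)) \<partial>distr D borel (\<lambda>t. t)) \<le> ennreal ((2 + I) * \<delta> powr (1 - 1/q))" .
    then show ?thesis using I0 \<delta> by (intro integral_real_bounded) auto
  qed
  then show ?thesis by blast
qed

theorem theorem1p1:
  fixes D :: "real measure" and p :: ennreal and x1 :: real
    and M :: "'a measure" and X Y :: "nat \<Rightarrow> 'a \<Rightarrow> real"
  assumes D: "prob_space D" "space D = {0..<1}" "sets D = sets (restrict_space borel {0..<1})"
    and p: "1 \<le> p"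
    and density: "has_Lp_density p D"
    and x1: "x1 \<in> {0..<1}"
    and M: "prob_space M"
    and Y_indep: "prob_space.indep_vars M (\<lambda>_. D) Y {1..}"
    and Y_distr: "\<And>n. n \<ge> 1 \<Longrightarrow> distr M D (Y n) = D"
    and X_start: "\<And>\<omega>. \<omega> \<in> space M \<Longrightarrow> X 1 \<omega> = x1"
    and X_step: "\<And>N \<omega>. N \<ge> 1 \<Longrightarrow> \<omega> \<in> space M \<Longrightarrow> X (N + 1) \<omega> = frac (X N \<omega> + Y N \<omega>)"
  shows "(p > 1 \<longrightarrow> (AE \<omega> in M. poissonian_pair_correlations (\<lambda>n. X n \<omega>))) \<and>
         (p = 1 \<longrightarrow> (\<forall>s\<ge>0. (\<lambda>N. prob_space.expectation M (\<lambda>\<omega>. pair_corr (\<lambda>n. X n \<omega>) s N))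
                               \<longlonglongrightarrow> 2 * s))"
proof -
  interpret M: prob_space M by fact
  interpret D: prob_space D by fact
  obtain f where fLp: "f \<in> Lp p lborel_unit" and fpos: "AE t in lborel_unit. 0 \<le> f t"
    and fD: "D = density lborel_unit (\<lambda>t. ennreal (f t))"
    using density unfolding has_Lp_density_def by blast
  have fm: "f \<in> borel_measurable lborel_unit" using fLp by (simp add: Lp_def)
  define K where "K = distr D borel (\<lambda>t. t)"
  have idm: "(\<lambda>t. t) \<in> measurable D borel"
    unfolding fD by (auto intro!: measurable_unit)
  have Ym: "Y n \<in> measurable M D" if "1 \<le> n" for n
    using Y_indep that by (auto simp: M.indep_vars_def)
  interpret step_walk K "\<lambda>t. ennreal (indicator {0..<1} t * f t)" M Y
  proof (intro step_walk.intro ac_law.intro borel_prob.intro borel_prob_axioms.intro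
      ac_law_axioms.intro step_walk_axioms.intro M)
    show "prob_space K" unfolding K_def by (rule D.prob_space_distr[OF idm])
    show "sets K = sets borel" by (simp add: K_def)
    show "(\<lambda>t. ennreal (indicator {0..<1} t * f t)) \<in> borel_measurable borel"
      "K = density lborel (\<lambda>t. ennreal (indicator {0..<1} t * f t))"
      unfolding K_def by (rule step_law_density[OF fm fD])+
    show "M.indep_vars (\<lambda>_. borel) Y {1..}"
      using M.indep_vars_compose2[OF Y_indep, of "\<lambda>_ t. t" "\<lambda>_. borel"] idm by simp
    show "distr M borel (Y n) = K" if "1 \<le> n" for n
    proof -
      have "K = distr (distr M D (Y n)) borel (\<lambda>t. t)" unfolding K_def Y_distr[OF that] ..
      also have "\<dots> = distr M borel (Y n)"
        using idm Ym[OF that] by (subst distr_distr) (auto simp: comp_def)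
      finally show ?thesis ..
    qed
  qed
  \<comment> \<open>Each step of the walk subtracts an integer, the floor, so displacements of
    \<open>X\<close> and sums of steps agree modulo 1.\<close>
  have diff: "X (i + k) \<omega> - X i \<omega> - incr {i..<i + k} \<omega> \<in> \<int>" if "1 \<le> i" "\<omega> \<in> space M" for i k \<omega>
  proof (induction k)
    case (Suc k)
    have "X (i + Suc k) \<omega> = frac (X (i + k) \<omega> + Y (i + k) \<omega>)"
      using X_step[of "i + k" \<omega>] that by simp
    then have "X (i + Suc k) \<omega> - X i \<omega> - incr {i..<i + Suc k} \<omega>
      = (X (i + k) \<omega> - X i \<omega> - incr {i..<i + k} \<omega>) - of_int \<lfloor>X (i + k) \<omega> + Y (i + k) \<omega>\<rfloor>"
      by (simp add: frac_def incr_def)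
    then show ?case using Ints_diff[OF Suc Ints_of_int] by (simp only:)
  qed (simp add: incr_def)
  \<comment> \<open>The pair correlation depends on the steps alone: the nearest-integer distance
    ignores the integers just found, and symmetry takes care of the order of \<open>i\<close> and
    \<open>j\<close>.\<close>
  have corr: "pair_corr (\<lambda>n. X n \<omega>) s N = 2 / real N * (\<Sum>p\<in>index_pairs N. near_ind (s / real N) p \<omega>)"
    if \<omega>: "\<omega> \<in> space M" for \<omega> s N
  proof -
    have "near_int \<delta> (X i \<omega> - X j \<omega>) = near_ind \<delta> (i, j) \<omega>" if ij: "1 \<le> i" "i < j" for i j \<delta>
    proof -
      have "X j \<omega> - X i \<omega> - incr {i..<j} \<omega> \<in> \<int>" using diff[OF ij(1) \<omega>, of "j - i"] ij by simp
      then have "dist_nearest_int (X j \<omega> - X i \<omega>) = dist_nearest_int (incr {i..<j} \<omega>)"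
        by (rule dist_nearest_int_add_int)
      then show ?thesis using dist_nearest_int_minus[of "X j \<omega> - X i \<omega>"] by (simp add: near_ind_def near_int_iff)
    qed
    then have "(\<Sum>(i, j)\<in>index_pairs N. near_int (s / real N) (X i \<omega> - X j \<omega>)) = (\<Sum>p\<in>index_pairs N. near_ind (s / real N) p \<omega>)"
      by (intro sum.cong refl) (auto simp: index_pairs_def)
    then show ?thesis by (simp add: pair_corr_index_pairs)
  qed
  have "(\<lambda>N. M.expectation (\<lambda>\<omega>. pair_corr (\<lambda>n. X n \<omega>) s N)) \<longlonglongrightarrow> 2 * s" if "0 \<le> s" for s
  proof -
    have "M.expectation (\<lambda>\<omega>. pair_corr (\<lambda>n. X n \<omega>) s N)
       = 2 / real N * M.expectation (\<lambda>\<omega>. \<Sum>p\<in>index_pairs N. near_ind (s / real N) p \<omega>)" for N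
    proof -
      have "M.expectation (\<lambda>\<omega>. pair_corr (\<lambda>n. X n \<omega>) s N)
         = M.expectation (\<lambda>\<omega>. 2 / real N * (\<Sum>p\<in>index_pairs N. near_ind (s / real N) p \<omega>))"
        by (intro Bochner_Integration.integral_cong refl corr)
      then show ?thesis by simp
    qed
    then show ?thesis using expectation_pairs_tendsto[OF that] by simp
  qed
  moreover have "AE \<omega> in M. poissonian_pair_correlations (\<lambda>n. X n \<omega>)" if p1: "1 < p"
  proof -
    obtain q where q: "1 < q" "integrable lborel_unit (\<lambda>t. \<bar>f t\<bar> powr q)"
      using Lp_unit_real_exponent[OF fLp p1] by blast
    define \<gamma> where "\<gamma> = 1 - 1 / q"
    have \<gamma>: "0 < \<gamma>" using q by (simp add: \<gamma>_def)
    obtain B where B: "\<And>\<delta> x. 0 < \<delta> \<Longrightarrow> \<delta> < 1/2 \<Longrightarrow> (\<integral>t. near_int \<delta> (x + t) \<partial>K) \<le> B * \<delta> powr \<gamma>"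
      using near_int_holder[OF fm fD fpos q] unfolding K_def \<gamma>_def by blast
    \<comment> \<open>Chosen so that both A \<ge> 4 and A \<gamma> \<ge> 4 hold.\<close>
    define A where "A = max 4 (nat \<lceil>4 / \<gamma>\<rceil>)"
    have A: "4 \<le> A" by (simp add: A_def)
    have "4 / \<gamma> \<le> real A" unfolding A_def by linarith
    then have A\<gamma>: "4 \<le> real A * \<gamma>" using \<gamma> by (simp add: field_simps)
    \<comment> \<open>The exceptional null set depends on \<open>s\<close>. Restriction to countably
      many \<open>s\<close> gives a common one, and the monotone interpolation below recovers every
      real \<open>s\<close>.\<close>
    have "AE \<omega> in M. \<forall>s\<in>\<rat> \<inter> {0<..}. (\<lambda>m. 2 / real (m ^ A) * (\<Sum>p\<in>index_pairs (m ^ A). near_ind (s / real (m ^ A)) p \<omega>)) \<longlonglongrightarrow> 2 * s"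
    proof (subst AE_ball_countable)
      show "countable (\<rat> \<inter> {0 :: real<..})" using countable_rat by (rule countable_subset[rotated]) auto
      show "\<forall>s\<in>\<rat> \<inter> {0<..}. AE \<omega> in M. (\<lambda>m. 2 / real (m ^ A) * (\<Sum>p\<in>index_pairs (m ^ A). near_ind (s / real (m ^ A)) p \<omega>)) \<longlonglongrightarrow> 2 * s"
        by (intro ballI AE_tendsto_along_powers[OF \<gamma> B A A\<gamma>]) auto
    qed
    moreover have "AE \<omega> in M. \<omega> \<in> space M" by (rule AE_space)
    ultimately show ?thesis
    proof eventually_elim
      case (elim \<omega>)
      show ?case
      proof (rule poissonian_if_poissonian_along_powers[of A])
        show "1 \<le> A" using A by simp
        fix q :: real assume "q \<in> \<rat>" "0 < q"
        then show "(\<lambda>m. pair_corr (\<lambda>n. X n \<omega>) q (m ^ A)) \<longlonglongrightarrow> 2 * q"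
          using elim by (simp add: corr)
      qed
    qed
  qed
  ultimately show ?thesis by blast
qed

end
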